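(* Let $M=\Gamma\backslash G$ be an Oeljeklaus--Toma manifold, where $G=\mathbb{R}^s\ltimes_\phi(\mathbb{R}^s\times\mathbb{C}^t)$ and $\Gamma=U\ltimes_\phi\mathcal{O}$. Then $M$ does not admit any Vaisman structure (with respect to any complex structure on $M$, left-invariant or not).
   Context: Oeljeklaus--Toma (OT) manifolds. Let $K$ be a number field with $s\ge 1$ real embeddings $\sigma_1,\dots,\sigma_s$ and $2t\geq 2$ non-real complex embeddings $\sigma_{s+1},\dots,\sigma_{s+2t}$ with $\sigma_{s+t+i}=\overline{\sigma_{s+i}}$ for $1\le i\le t$. Let $\mathcal{O}_K$ be its ring of integers and $\mathcal{O}_K^{*,+}$ the group of units $u$ with $\sigma_j(u)>0$ for $1\le j\le s$. Let $U\le\mathcal{O}_K^{*,+}$ be a free abelian subgroup of rank $s$ which is admissible, i.e. whose image under $u\mapsto(\log\sigma_1(u),\dots,\log\sigma_s(u))$ is a lattice in $\mathbb{R}^s$. Then one can choose a complex matrix $C=(c_{ij})_{1\le i\le t,\,1\le j\le s}$ with $\sigma_{s+i}(u)=\exp\big(\sum_{j=1}^s c_{ij}\log\sigma_j(u)\big)$ for all $u\in U$ and $1\le i\le t$. Define $$\phi(a_1,\dots,a_s)=\mathrm{diag}\Big(e^{a_1},\dots,e^{a_s},\exp\sum_{j=1}^s c_{1j}a_j,\dots,\exp\sum_{j=1}^s c_{tj}a_j\Big)$$ acting on $\mathbb{R}^s\times\mathbb{C}^t$, and $G=\mathbb{R}^s\ltimes_\phi(\mathbb{R}^s\times\mathbb{C}^t)$,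 with multiplication $(a,x)(b,y)=(a+b,\,x+\phi(a)y)$. Identify $U$ with its image lattice in $\mathbb{R}^s$, and let $\mathcal{O}$ be the image of $\mathcal{O}_K$ in $\mathbb{R}^s\times\mathbb{C}^t$ under $(\sigma_1,\dots,\sigma_{s+t})$, which is a lattice. Then $\Gamma=U\ltimes_\phi\mathcal{O}$ is a lattice in $G$ (a discrete cocompact subgroup), and the solvmanifold $M=\Gamma\backslash G$ is called an OT manifold. Vaisman structures. Let $(M,J,\omega)$ be a Hermitian manifold of real dimension at least $4$, with (integrable) complex structure $J$, fundamental form $\omega$ and metric $g$. A triple $(J,\omega,\theta)$ is a locally conformally Kähler (LCK) structure if $\theta$ is a closed 1-form with $d\omega=\theta\wedge\omega$. It is globally conformally Kähler (GCK) if $\theta$ is exact. It is Vaisman if it is LCK and $\nabla^g\theta=0$ for the Levi-Civita connection $\nabla^g$. Standing assumption: LCK (in particular Vaisman) structures are assumed not to be GCK. *)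

theory Defs
  imports "HOL-Analysis.Analysis" "HOL-Algebra.Free_Abelian_Groups"
begin

section \<open>Smooth maps on open subsets of Euclidean space\<close>

abbreviation ddir :: "('a::euclidean_space \<Rightarrow> 'b::real_normed_vector) \<Rightarrow> 'a \<Rightarrow> 'a \<Rightarrow> 'b" where
  "ddir f x v \<equiv> frechet_derivative f (at x) v"

text \<open>The following two notions are only used for open sets \<open>S\<close>.\<close>

primrec Ck_on :: "nat \<Rightarrow> 'a set \<Rightarrow> ('a::euclidean_space \<Rightarrow> 'b::real_normed_vector) \<Rightarrow> bool" where
  "Ck_on 0 S f \<longleftrightarrow> continuous_on S f"
| "Ck_on (Suc k) S f \<longleftrightarrow> f differentiable_on S \<and> (\<forall>v. Ck_on k S (\<lambda>x. ddir f x v))"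

definition smooth_on :: "'a set \<Rightarrow> ('a::euclidean_space \<Rightarrow> 'b::real_normed_vector) \<Rightarrow> bool" where
  "smooth_on S f \<longleftrightarrow> (\<forall>k. Ck_on k S f)"

definition lie_bracket :: "('a::euclidean_space \<Rightarrow> 'a) \<Rightarrow> ('a \<Rightarrow> 'a) \<Rightarrow> 'a \<Rightarrow> 'a" where
  "lie_bracket X Y x = ddir Y x (X x) - ddir X x (Y x)"


section \<open>Charts and tensor fields\<close>

text \<open>
  A chart \<open>(D, \<phi>)\<close> on a set of points consists of its domain \<open>D\<close> and a coordinate map \<open>\<phi>\<close> that is
  injective on \<open>D\<close> with open image.  A manifold is represented by a smooth atlas, i.e. a set of
  charts whose domains cover it and whose transition maps are smooth on their open domains.
  A tensor field is a family, indexed by the charts, of tensor fields on the chart images that obey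
  the transformation law on overlaps; its values outside the atlas or the chart images are
  irrelevant.
\<close>

type_synonym ('p, 'e) chart = "'p set \<times> ('p \<Rightarrow> 'e)"

definition chart_image :: "('p, 'e) chart \<Rightarrow> 'e set" where
  "chart_image c = snd c ` fst c"

definition chart_inv :: "('p, 'e) chart \<Rightarrow> 'e \<Rightarrow> 'p" where
  "chart_inv c = inv_into (fst c) (snd c)"

definition overlap :: "('p, 'e) chart \<Rightarrow> ('p, 'e) chart \<Rightarrow> 'e set" where
  "overlap c d = snd c ` (fst c \<inter> fst d)"

definition transition :: "('p, 'e) chart \<Rightarrow> ('p, 'e) chart \<Rightarrow> 'e \<Rightarrow> 'e" where
  "transition c d = snd d \<circ> chart_inv c"

definition smooth_function ::
  "('p, 'e::euclidean_space) chart set \<Rightarrow> ('p \<Rightarrow> real) \<Rightarrow> bool" where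
  "smooth_function A f \<longleftrightarrow> (\<forall>c\<in>A. smooth_on (chart_image c) (f \<circ> chart_inv c))"

type_synonym ('p, 'e) one_form = "('p, 'e) chart \<Rightarrow> 'e \<Rightarrow> 'e \<Rightarrow> real"
type_synonym ('p, 'e) bil_form = "('p, 'e) chart \<Rightarrow> 'e \<Rightarrow> 'e \<Rightarrow> 'e \<Rightarrow> real"
type_synonym ('p, 'e) endo_field = "('p, 'e) chart \<Rightarrow> 'e \<Rightarrow> 'e \<Rightarrow> 'e"

definition is_one_form ::
  "('p, 'e::euclidean_space) chart set \<Rightarrow> ('p, 'e) one_form \<Rightarrow> bool" where
  "is_one_form A \<theta> \<longleftrightarrow>
     (\<forall>c\<in>A. (\<forall>x\<in>chart_image c. linear (\<theta> c x)) \<and>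
            (\<forall>v. smooth_on (chart_image c) (\<lambda>x. \<theta> c x v))) \<and>
     (\<forall>c\<in>A. \<forall>d\<in>A. \<forall>x\<in>overlap c d. \<forall>v.
        \<theta> c x v = \<theta> d (transition c d x) (ddir (transition c d) x v))"

definition is_two_form ::
  "('p, 'e::euclidean_space) chart set \<Rightarrow> ('p, 'e) bil_form \<Rightarrow> bool" where
  "is_two_form A \<omega> \<longleftrightarrow>
     (\<forall>c\<in>A. (\<forall>x\<in>chart_image c. bilinear (\<omega> c x) \<and> (\<forall>v. \<omega> c x v v = 0)) \<and>
            (\<forall>u v. smooth_on (chart_image c) (\<lambda>x. \<omega> c x u v))) \<and>
     (\<forall>c\<in>A. \<forall>d\<in>A. \<forall>x\<in>overlap c d. \<forall>u v.
        \<omega> c x u v = \<omega> d (transition c d x) (ddir (transition c d) x u) (ddir (transition c d) x v))"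

definition is_endo_field ::
  "('p, 'e::euclidean_space) chart set \<Rightarrow> ('p, 'e) endo_field \<Rightarrow> bool" where
  "is_endo_field A J \<longleftrightarrow>
     (\<forall>c\<in>A. (\<forall>x\<in>chart_image c. linear (J c x)) \<and>
            (\<forall>v. smooth_on (chart_image c) (\<lambda>x. J c x v))) \<and>
     (\<forall>c\<in>A. \<forall>d\<in>A. \<forall>x\<in>overlap c d. \<forall>v.
        ddir (transition c d) x (J c x v) = J d (transition c d x) (ddir (transition c d) x v))"

definition closed_one_form ::
  "('p, 'e::euclidean_space) chart set \<Rightarrow> ('p, 'e) one_form \<Rightarrow> bool" where
  "closed_one_form A \<theta> \<longleftrightarrow>
     (\<forall>c\<in>A. \<forall>x\<in>chart_image c. \<forall>u v.
        ddir (\<lambda>y. \<theta> c y v) x u - ddir (\<lambda>y. \<theta> c y u) x v = 0)"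

definition exact_one_form ::
  "('p, 'e::euclidean_space) chart set \<Rightarrow> ('p, 'e) one_form \<Rightarrow> bool" where
  "exact_one_form A \<theta> \<longleftrightarrow>
     (\<exists>f. smooth_function A f \<and>
        (\<forall>c\<in>A. \<forall>x\<in>chart_image c. \<forall>v. \<theta> c x v = ddir (f \<circ> chart_inv c) x v))"

text \<open>Exterior derivative of a two-form, and wedge product of a one-form with a two-form, in a chart
  (\<open>u\<close>, \<open>v\<close>, \<open>w\<close> are extended to constant vector fields).\<close>

definition ext_deriv2 :: "('p, 'e::euclidean_space) bil_form \<Rightarrow>
    ('p, 'e) chart \<Rightarrow> 'e \<Rightarrow> 'e \<Rightarrow> 'e \<Rightarrow> 'e \<Rightarrow> real" where
  "ext_deriv2 \<omega> c x u v w =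
     ddir (\<lambda>y. \<omega> c y v w) x u - ddir (\<lambda>y. \<omega> c y u w) x v + ddir (\<lambda>y. \<omega> c y u v) x w"

definition wedge12 :: "('p, 'e) one_form \<Rightarrow> ('p, 'e) bil_form \<Rightarrow>
    ('p, 'e) chart \<Rightarrow> 'e \<Rightarrow> 'e \<Rightarrow> 'e \<Rightarrow> 'e \<Rightarrow> real" where
  "wedge12 \<theta> \<omega> c x u v w = \<theta> c x u * \<omega> c x v w - \<theta> c x v * \<omega> c x u w + \<theta> c x w * \<omega> c x u v"


section \<open>Hermitian, LCK and Vaisman structures\<close>

text \<open>Integrability is the vanishing of the Nijenhuis tensor.\<close>

definition complex_structure ::
  "('p, 'e::euclidean_space) chart set \<Rightarrow> ('p, 'e) endo_field \<Rightarrow> bool" where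
  "complex_structure A J \<longleftrightarrow>
     is_endo_field A J \<and>
     (\<forall>c\<in>A. \<forall>x\<in>chart_image c. \<forall>v. J c x (J c x v) = - v) \<and>
     (\<forall>c\<in>A. \<forall>X Y. smooth_on (chart_image c) X \<longrightarrow> smooth_on (chart_image c) Y \<longrightarrow>
        (\<forall>x\<in>chart_image c.
           lie_bracket (\<lambda>y. J c y (X y)) (\<lambda>y. J c y (Y y)) x
           - J c x (lie_bracket (\<lambda>y. J c y (X y)) Y x)
           - J c x (lie_bracket X (\<lambda>y. J c y (Y y)) x)
           - lie_bracket X Y x = 0))"

text \<open>The metric of \<open>(J, \<omega>)\<close>, with the convention \<open>\<omega>(u, v) = g(J u, v)\<close>.\<close>

definition metric_of :: "('p, 'e) endo_field \<Rightarrow> ('p, 'e) bil_form \<Rightarrow> ('p, 'e) bil_form" where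
  "metric_of J \<omega> c x u v = \<omega> c x u (J c x v)"

definition hermitian_structure :: "('p, 'e::euclidean_space) chart set \<Rightarrow>
    ('p, 'e) endo_field \<Rightarrow> ('p, 'e) bil_form \<Rightarrow> bool" where
  "hermitian_structure A J \<omega> \<longleftrightarrow>
     complex_structure A J \<and> is_two_form A \<omega> \<and>
     (\<forall>c\<in>A. \<forall>x\<in>chart_image c.
        (\<forall>u v. \<omega> c x (J c x u) (J c x v) = \<omega> c x u v) \<and>
        (\<forall>v. v \<noteq> 0 \<longrightarrow> metric_of J \<omega> c x v v > 0))"

text \<open>In a chart, a connection is \<open>\<nabla>\<^sub>X Y = D\<^sub>X Y + \<Gamma>(X, Y)\<close> for a field \<open>\<Gamma>\<close> of bilinear maps
  (the Christoffel symbols).\<close>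

definition cov_deriv ::
  "('e::euclidean_space \<Rightarrow> 'e \<Rightarrow> 'e \<Rightarrow> 'e) \<Rightarrow> ('e \<Rightarrow> 'e) \<Rightarrow> ('e \<Rightarrow> 'e) \<Rightarrow> 'e \<Rightarrow> 'e" where
  "cov_deriv \<Gamma> X Y x = ddir Y x (X x) + \<Gamma> x (X x) (Y x)"

definition levi_civita_on :: "'e set \<Rightarrow> ('e::euclidean_space \<Rightarrow> 'e \<Rightarrow> 'e \<Rightarrow> real) \<Rightarrow>
    ('e \<Rightarrow> 'e \<Rightarrow> 'e \<Rightarrow> 'e) \<Rightarrow> bool" where
  "levi_civita_on S g \<Gamma> \<longleftrightarrow>
     (\<forall>x\<in>S. bilinear (\<Gamma> x)) \<and> (\<forall>u v. smooth_on S (\<lambda>x. \<Gamma> x u v)) \<and>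
     (\<forall>X Y. smooth_on S X \<longrightarrow> smooth_on S Y \<longrightarrow>
        (\<forall>x\<in>S. cov_deriv \<Gamma> X Y x - cov_deriv \<Gamma> Y X x = lie_bracket X Y x)) \<and>
     (\<forall>X Y Z. smooth_on S X \<longrightarrow> smooth_on S Y \<longrightarrow> smooth_on S Z \<longrightarrow>
        (\<forall>x\<in>S. ddir (\<lambda>y. g y (Y y) (Z y)) x (X x) =
           g x (cov_deriv \<Gamma> X Y x) (Z x) + g x (Y x) (cov_deriv \<Gamma> X Z x)))"

text \<open>\<open>\<nabla>\<theta> = 0\<close> for the Levi-Civita connection of \<open>g\<close>.  The Christoffel symbols on each chart image
  exist and are unique, so the existential quantifier only names them.\<close>

definition parallel_one_form :: "('p, 'e::euclidean_space) chart set \<Rightarrow>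
    ('p, 'e) bil_form \<Rightarrow> ('p, 'e) one_form \<Rightarrow> bool" where
  "parallel_one_form A g \<theta> \<longleftrightarrow>
     (\<forall>c\<in>A. \<exists>\<Gamma>. levi_civita_on (chart_image c) (g c) \<Gamma> \<and>
        (\<forall>X Y. smooth_on (chart_image c) X \<longrightarrow> smooth_on (chart_image c) Y \<longrightarrow>
          (\<forall>x\<in>chart_image c.
             ddir (\<lambda>y. \<theta> c y (Y y)) x (X x) - \<theta> c x (cov_deriv \<Gamma> X Y x) = 0)))"

definition LCK_structure :: "('p, 'e::euclidean_space) chart set \<Rightarrow>
    ('p, 'e) endo_field \<Rightarrow> ('p, 'e) bil_form \<Rightarrow> ('p, 'e) one_form \<Rightarrow> bool" where
  "LCK_structure A J \<omega> \<theta> \<longleftrightarrow>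
     hermitian_structure A J \<omega> \<and> is_one_form A \<theta> \<and> closed_one_form A \<theta> \<and>
     (\<forall>c\<in>A. \<forall>x\<in>chart_image c. \<forall>u v w. ext_deriv2 \<omega> c x u v w = wedge12 \<theta> \<omega> c x u v w) \<and>
     \<not> exact_one_form A \<theta>"
  \<comment> \<open>the last conjunct is the convention that LCK structures are not globally conformally Kaehler\<close>

definition vaisman_structure :: "('p, 'e::euclidean_space) chart set \<Rightarrow>
    ('p, 'e) endo_field \<Rightarrow> ('p, 'e) bil_form \<Rightarrow> ('p, 'e) one_form \<Rightarrow> bool" where
  "vaisman_structure A J \<omega> \<theta> \<longleftrightarrow>
     LCK_structure A J \<omega> \<theta> \<and> parallel_one_form A (metric_of J \<omega>) \<theta>"


section \<open>Quotients of Lie groups\<close>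

text \<open>
  Let \<open>G\<close> be a Lie group whose underlying manifold is a Euclidean space (with its identity chart) and
  \<open>H\<close> a discrete subgroup.  The points of the quotient by left translations are the cosets \<open>H g\<close>, and
  its smooth structure is the one for which the projection is a local diffeomorphism: the charts are
  the inverses of the projection restricted to open sets on which it is injective.
\<close>

definition quotient_atlas ::
  "('e::euclidean_space, 'm) monoid_scheme \<Rightarrow> 'e set \<Rightarrow> ('e set, 'e) chart set" where
  "quotient_atlas G H =
     {((\<lambda>g. H #>\<^bsub>G\<^esub> g) ` V, inv_into V (\<lambda>g. H #>\<^bsub>G\<^esub> g)) | V.
        open V \<and> inj_on (\<lambda>g. H #>\<^bsub>G\<^esub> g) V}"


text \<open>In the chart given by \<open>V\<close>, the image is \<open>V\<close> and the inverse coordinate map is the projection.\<close>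

lemma quotient_chart:
  assumes "inj_on p V" and "c = (p ` V, inv_into V p)"
  shows "chart_image c = V" and "x \<in> V \<Longrightarrow> chart_inv c x = p x"
proof -
  show "chart_image c = V"
    using assms by (force simp: chart_image_def image_image)
  assume x: "x \<in> V"
  have "inj_on (inv_into V p) (p ` V)"
    by (rule inj_on_inv_into) simp
  moreover have "inv_into V p (p x) = x"
    using assms(1) x by simp
  ultimately show "chart_inv c x = p x"
    using assms(2) x by (metis chart_inv_def fst_conv imageI inv_into_f_f snd_conv)
qed


section \<open>Number fields\<close>

definition number_field :: "'k::field_char_0 itself \<Rightarrow> bool" where
  "number_field _ \<longleftrightarrow>
     (\<exists>B::'k set. finite B \<and> module.span (\<lambda>(q::rat) x. of_rat q * x) B = UNIV)"

definition field_embedding :: "('a::field \<Rightarrow> 'b::field) \<Rightarrow> bool" where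
  "field_embedding f \<longleftrightarrow>
     f 1 = 1 \<and> (\<forall>x y. f (x + y) = f x + f y) \<and> (\<forall>x y. f (x * y) = f x * f y)"

text \<open>\<open>\<sigma>\<close> lists the real embeddings, and \<open>\<tau>\<close> lists one embedding out of each pair of conjugate
  non-real complex embeddings.\<close>

definition lists_embeddings ::
  "('s \<Rightarrow> 'k::field_char_0 \<Rightarrow> real) \<Rightarrow> ('t \<Rightarrow> 'k \<Rightarrow> complex) \<Rightarrow> bool" where
  "lists_embeddings \<sigma> \<tau> \<longleftrightarrow>
     bij_betw \<sigma> UNIV {f. field_embedding f} \<and>
     inj \<tau> \<and> range \<tau> \<inter> range (\<lambda>i. cnj \<circ> \<tau> i) = {} \<and>
     range \<tau> \<union> range (\<lambda>i. cnj \<circ> \<tau> i) = {f. field_embedding f \<and> \<not> range f \<subseteq> \<real>}"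

definition ring_of_integers :: "'k::field_char_0 set" where
  "ring_of_integers = {x. algebraic_int x}"

definition positive_units :: "('s \<Rightarrow> 'k::field_char_0 \<Rightarrow> real) \<Rightarrow> 'k monoid" where
  "positive_units \<sigma> =
     \<lparr>carrier = {u. u \<noteq> 0 \<and> u \<in> ring_of_integers \<and> inverse u \<in> ring_of_integers \<and> (\<forall>j. \<sigma> j u > 0)},
      monoid.mult = (*), one = 1\<rparr>"

definition log_embedding :: "('s::finite \<Rightarrow> 'k \<Rightarrow> real) \<Rightarrow> 'k \<Rightarrow> real ^ 's" where
  "log_embedding \<sigma> u = (\<chi> j. ln (\<sigma> j u))"

definition lattice_in_space :: "'a::euclidean_space set \<Rightarrow> bool" where
  "lattice_in_space L \<longleftrightarrow>
     0 \<in> L \<and> (\<forall>x\<in>L. \<forall>y\<in>L. x - y \<in> L) \<and> discrete L \<and> span L = UNIV"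


section \<open>Oeljeklaus--Toma manifolds\<close>

definition OT_phi :: "complex ^ 's ^ 't \<Rightarrow> real ^ 's \<Rightarrow>
    (real ^ 's) \<times> (complex ^ 't) \<Rightarrow> (real ^ 's::finite) \<times> (complex ^ 't::finite)" where
  "OT_phi C a x =
     (\<chi> j. exp (a $ j) * fst x $ j,
      \<chi> i. exp (\<Sum>j\<in>UNIV. C $ i $ j * of_real (a $ j)) * snd x $ i)"

definition OT_group :: "complex ^ 's ^ 't \<Rightarrow>
    ((real ^ 's::finite) \<times> (real ^ 's) \<times> (complex ^ 't::finite)) monoid" where
  "OT_group C =
     \<lparr>carrier = UNIV,
      monoid.mult = (\<lambda>(a, x) (b, y). (a + b, x + OT_phi C a y)),
      one = (0, 0)\<rparr>"

definition OT_lattice :: "('s::finite \<Rightarrow> 'k::field_char_0 \<Rightarrow> real) \<Rightarrow>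
    ('t::finite \<Rightarrow> 'k \<Rightarrow> complex) \<Rightarrow> 'k set \<Rightarrow>
    ((real ^ 's) \<times> (real ^ 's) \<times> (complex ^ 't)) set" where
  "OT_lattice \<sigma> \<tau> U =
     log_embedding \<sigma> ` U \<times> (\<lambda>x. (\<chi> j. \<sigma> j x, \<chi> i. \<tau> i x)) ` ring_of_integers"

end

(*
  Only a metric g on M and a parallel closed one-form theta that is not exact matter.  Let X be the
  vector field dual to theta; it is Killing, and theta(X) is a positive constant.  On the universal
  cover G write theta = dF; then F grows linearly along the flow of X, while F changes under Gamma by
  a homomorphism to the reals, which kills O_K because (u - 1) O_K has finite index.

  The flow commutes with Gamma, so it carries the segment from 0 to its translate by 1 in O_K to a
  curve of the same length from a point p to its translate by 1.  Move p into a compact fundamental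
  domain by some (u, o) in Gamma: the end points then differ by the translation by u, so all
  embeddings of u are bounded and u lies in a finite set.  Hence F(p) is bounded, a contradiction for
  long times.

  No flow has to be constructed: Gamma acts on G by affine maps, so the Euler step x + t X(x) commutes
  with Gamma, and by cocompactness it distorts g by o(t) uniformly.
*)
theory Submission
  imports Defs "Jordan_Normal_Form.Char_Poly"
begin

no_notation vec_index (infixl "$" 100) and scalar_prod (infix "\<bullet>" 70)

section \<open>Algebraic integers\<close>

text \<open>The order of the choices shapes the estimate. The bounds on the displacement, on the
  units and on the change of F under the lattice must all be fixed before the time is chosen, so the
  total distortion of g has to stay bounded however long the time is. Hence the error of an Euler
  step is made small relative to the total time: \<open>n\<close> steps then distort g by at most
  \<open>(1 + 1 / n) ^ n\<close>, which is below 3. A single step has error o(t) because the field X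
  is itself parallel, and the symmetry of the Christoffel symbols makes the first-order change of g
  along X vanish. Two facts about the integers of K enter. That they span, and so that the action is
  cocompact, rests on the linear independence of the embeddings. That they are discrete, and so that
  boundedness leaves only finitely many units, is read off from the atlas: as theta is not exact, it
  is nonzero in some chart, hence the projection is injective on some nonempty open set. Right
  translates of this set also yield charts around all other points of G.\<close>

lemma algebraic_int_if_eigenvalue:
  fixes z :: "'a::field_char_0" and A :: "int mat"
  assumes A: "A \<in> carrier_mat n n" and z: "eigenvalue (map_mat of_int A) z"
  shows "algebraic_int z"
proof -
  have "poly (char_poly (map_mat of_int A)) z = 0"
    using z eigenvalue_root_char_poly[of "map_mat of_int A" n z] A by auto
  then have "poly (map_poly of_int (char_poly A)) z = 0"
    by (simp add: of_int_hom.char_poly_hom[OF A])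
  moreover have "lead_coeff (char_poly A) = 1"
    using degree_monic_char_poly[OF A] by simp
  ultimately show ?thesis
    unfolding algebraic_int_altdef_ipoly by blast
qed

text \<open>A family of generators instead of a set: the monomials \<open>x ^ i * y ^ j\<close> to
  which it is applied need not be distinct.\<close>

definition int_span :: "('b \<Rightarrow> 'a::field_char_0) \<Rightarrow> 'b set \<Rightarrow> 'a set" where
  "int_span b I = {\<Sum>k\<in>I. of_int (c k) * b k | c. True}"

lemma int_span_add: "x \<in> int_span b I \<Longrightarrow> y \<in> int_span b I \<Longrightarrow> x + y \<in> int_span b I"
  unfolding int_span_def
proof clarsimp
  fix c d :: "'b \<Rightarrow> int"
  show "\<exists>e. (\<Sum>k\<in>I. of_int (c k) * b k) + (\<Sum>k\<in>I. of_int (d k) * b k) = (\<Sum>k\<in>I. of_int (e k) * b k)"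
    by (rule exI[of _ "\<lambda>k. c k + d k"]) (simp add: sum.distrib algebra_simps)
qed

lemma int_span_scale: "x \<in> int_span b I \<Longrightarrow> of_int m * x \<in> int_span b I"
  unfolding int_span_def
proof clarsimp
  fix c :: "'b \<Rightarrow> int"
  show "\<exists>e. of_int m * (\<Sum>k\<in>I. of_int (c k) * b k) = (\<Sum>k\<in>I. of_int (e k) * b k)"
    by (rule exI[of _ "\<lambda>k. m * c k"]) (simp add: sum_distrib_left algebra_simps)
qed

lemma int_span_base:
  assumes "finite I" "i \<in> I"
  shows "b i \<in> int_span b I"
proof -
  have "(\<Sum>k\<in>I. of_int (if k = i then 1 else 0) * b k) = (\<Sum>k\<in>I. if k = i then b k else 0)"
    by (rule sum.cong) auto
  also have "\<dots> = b i" using assms by (simp add: sum.delta')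
  finally show ?thesis
    unfolding int_span_def by (intro CollectI exI[of _ "\<lambda>k. if k = i then 1 else 0"]) simp
qed

lemma int_span_0: "0 \<in> int_span b I"
  unfolding int_span_def by (auto intro!: exI[of _ "\<lambda>k. 0"])

lemma int_span_sum: "(\<And>j. j \<in> J \<Longrightarrow> f j \<in> int_span b I) \<Longrightarrow> sum f J \<in> int_span b I"
  by (induction J rule: infinite_finite_induct) (auto simp: int_span_0 int_span_add)

lemma int_span_mult_stable:
  assumes "\<And>i. i \<in> I \<Longrightarrow> z * b i \<in> int_span b I" and "x \<in> int_span b I"
  shows "z * x \<in> int_span b I"
proof -
  obtain c where x: "x = (\<Sum>k\<in>I. of_int (c k) * b k)"
    using assms(2) unfolding int_span_def by auto
  have "z * x = (\<Sum>k\<in>I. of_int (c k) * (z * b k))"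
    by (simp add: x sum_distrib_left algebra_simps)
  then show ?thesis
    using assms(1) by (simp add: int_span_sum int_span_scale)
qed

text \<open>The determinant trick: the generators form an eigenvector, with eigenvalue
  \<open>z\<close>, of the integer matrix that expresses multiplication by \<open>z\<close>. The
  generator \<open>b i0\<close> keeps this vector from being zero.\<close>

lemma algebraic_int_if_stable:
  fixes z :: "'a::field_char_0"
  assumes fin: "finite I" and stab: "\<And>i. i \<in> I \<Longrightarrow> z * b i \<in> int_span b I"
    and nz: "i0 \<in> I" "b i0 \<noteq> 0"
  shows "algebraic_int z"
proof -
  define n where "n = card I"
  obtain h where h: "bij_betw h {..<n} I"
    using ex_bij_betw_nat_finite[OF fin] by (auto simp: n_def atLeast0LessThan)
  have "\<forall>i\<in>I. \<exists>c. z * b i = (\<Sum>k\<in>I. of_int (c k) * b k)"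
    using stab unfolding int_span_def by blast
  then obtain c where c: "\<And>i. i \<in> I \<Longrightarrow> z * b i = (\<Sum>k\<in>I. of_int (c i k) * b k)"
    using bchoice[of I "\<lambda>i c. z * b i = (\<Sum>k\<in>I. of_int (c k) * b k)"] by blast
  define A :: "int mat" where "A = mat n n (\<lambda>(i,j). c (h i) (h j))"
  define v where "v = Matrix.vec n (\<lambda>i. b (h i))"
  have A: "A \<in> carrier_mat n n" by (simp add: A_def)
  have hI: "h i \<in> I" if "i < n" for i using h that by (auto simp: bij_betw_def)
  have "mult_mat_vec (map_mat of_int A) v = smult_vec z v"
  proof (rule eq_vecI)
    fix i assume "i < dim_vec (smult_vec z v)"
    then have i: "i < n" by (simp add: v_def)
    have "vec_index (mult_mat_vec (map_mat of_int A) v) i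
        = (\<Sum>k\<in>{..<n}. of_int (c (h i) (h k)) * b (h k))"
      using i by (simp add: A_def v_def scalar_prod_def atLeast0LessThan)
    also have "\<dots> = (\<Sum>k\<in>I. of_int (c (h i) k) * b k)"
      using sum.reindex_bij_betw[OF h, of "\<lambda>k. of_int (c (h i) k) * b k"] by simp
    also have "\<dots> = z * b (h i)" using c[OF hI[OF i]] by simp
    finally show "vec_index (mult_mat_vec (map_mat of_int A) v) i = vec_index (smult_vec z v) i"
      using i by (simp add: v_def)
  qed (simp add: A_def v_def)
  moreover have "v \<noteq> zero_vec n"
  proof
    assume v0: "v = zero_vec n"
    obtain k where k: "k < n" "h k = i0" using h nz(1) by (auto simp: bij_betw_def)
    have "b i0 = vec_index v k" using k by (simp add: v_def)
    also have "\<dots> = 0" using k by (simp add: v0)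
    finally have "b i0 = 0" .
    then show False using nz by simp
  qed
  ultimately have "eigenvalue (map_mat of_int A) z"
    unfolding eigenvalue_def eigenvector_def by (intro exI[of _ v]) (simp add: A_def v_def)
  then show ?thesis by (rule algebraic_int_if_eigenvalue[OF A])
qed

text \<open>\<open>n > 0\<close> belongs to the conclusion because it later puts the monomial 1
  among the generators.\<close>

lemma algebraic_int_power_reduce:
  fixes x :: "'a::field_char_0"
  assumes "algebraic_int x"
  obtains n and a :: "nat \<Rightarrow> int" where "n > 0" "x ^ n = (\<Sum>k<n. of_int (a k) * x ^ k)"
proof -
  obtain p :: "int poly" where p: "poly (map_poly of_int p) x = 0" "lead_coeff p = 1"
    using assms unfolding algebraic_int_altdef_ipoly by auto
  define n where "n = degree p"
  have "n > 0"
  proof (rule ccontr)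
    assume "\<not> n > 0"
    then obtain a where "p = [:a:]" by (auto simp: n_def elim: degree_eq_zeroE)
    then have "p = [:1:]" using p(2) by simp
    then show False using p(1) by simp
  qed
  have "0 = (\<Sum>k\<le>n. of_int (coeff p k) * x ^ k)"
    using p(1) by (simp add: poly_altdef n_def degree_map_poly coeff_map_poly)
  also have "\<dots> = (\<Sum>k<n. of_int (coeff p k) * x ^ k) + x ^ n"
    using p(2) by (simp add: n_def sum.lessThan_Suc flip: lessThan_Suc_atMost)
  finally have "x ^ n = - (\<Sum>k<n. of_int (coeff p k) * x ^ k)"
    by (simp add: eq_neg_iff_add_eq_0 add.commute)
  then have "x ^ n = (\<Sum>k<n. of_int (- coeff p k) * x ^ k)"
    by (simp add: sum_negf)
  then show ?thesis using that[of n "\<lambda>k. - coeff p k"] \<open>n > 0\<close> by blast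
qed

text \<open>The products \<open>x ^ i * y ^ j\<close> with \<open>i < n\<close> and
  \<open>j < m\<close> generate a group that \<open>x\<close> and \<open>y\<close> both map into
  itself, because \<open>x ^ n\<close> and \<open>y ^ m\<close> reduce to lower powers. It is then
  stable under \<open>x + y\<close> and \<open>x * y\<close> too.\<close>

lemma
  fixes x y :: "'a::field_char_0"
  assumes "algebraic_int x" "algebraic_int y"
  shows algebraic_int_add: "algebraic_int (x + y)" and algebraic_int_mult: "algebraic_int (x * y)"
proof -
  obtain n a where n: "n > 0" and xn: "x ^ n = (\<Sum>k<n. of_int (a k) * x ^ k)"
    using algebraic_int_power_reduce[OF assms(1)] by blast
  obtain m c where m: "m > 0" and ym: "y ^ m = (\<Sum>k<m. of_int (c k) * y ^ k)"
    using algebraic_int_power_reduce[OF assms(2)] by blast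
  define I where "I = {..<n} \<times> {..<m}"
  define b where "b = (\<lambda>(i,j). x ^ i * y ^ j)"
  have fin: "finite I" by (simp add: I_def)
  have base: "x ^ i * y ^ j \<in> int_span b I" if "i < n" "j < m" for i j
    using int_span_base[OF fin, of "(i,j)" b] that by (simp add: I_def b_def)
  have X: "x * b i \<in> int_span b I" if iI: "i \<in> I" for i
  proof -
    obtain k l where kl: "i = (k,l)" "k < n" "l < m" using iI by (cases i) (auto simp: I_def)
    show ?thesis
    proof (cases "Suc k < n")
      case True
      then show ?thesis using base[of "Suc k" l] kl by (simp add: b_def mult.assoc)
    next
      case False
      then have "Suc k = n" using kl by simp
      then have "x * b i = x ^ n * y ^ l" using kl
        by (auto simp: b_def mult.assoc)
      also have "\<dots> = (\<Sum>k<n. of_int (a k) * (x ^ k * y ^ l))"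
        by (simp add: xn sum_distrib_right mult.assoc)
      finally show ?thesis using kl by (auto intro!: int_span_sum int_span_scale base)
    qed
  qed
  have Y: "y * b i \<in> int_span b I" if iI: "i \<in> I" for i
  proof -
    obtain k l where kl: "i = (k,l)" "k < n" "l < m" using iI by (cases i) (auto simp: I_def)
    show ?thesis
    proof (cases "Suc l < m")
      case True
      then show ?thesis using base[of k "Suc l"] kl by (simp add: b_def algebra_simps)
    next
      case False
      then have "Suc l = m" using kl by simp
      then have "y * b i = x ^ k * y ^ m" using kl by (auto simp: b_def)
      also have "\<dots> = (\<Sum>j<m. of_int (c j) * (x ^ k * y ^ j))"
        by (simp add: ym sum_distrib_left algebra_simps)
      finally show ?thesis using kl by (auto intro!: int_span_sum int_span_scale base)
    qed
  qed
  have 1: "(0,0) \<in> I" "b (0,0) \<noteq> 0" using n m by (auto simp: I_def b_def)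
  show "algebraic_int (x + y)"
    using fin _ 1 by (rule algebraic_int_if_stable) (simp add: distrib_right int_span_add X Y)
  show "algebraic_int (x * y)"
    using fin _ 1
  proof (rule algebraic_int_if_stable)
    fix i assume "i \<in> I"
    from int_span_mult_stable[OF X Y[OF this]] show "x * y * b i \<in> int_span b I"
      by (simp only: mult.assoc)
  qed
qed

lemma algebraic_int_diff:
  fixes x y :: "'a::field_char_0"
  assumes "algebraic_int x" "algebraic_int y"
  shows "algebraic_int (x - y)"
  using algebraic_int_add[OF assms(1) algebraic_int_minus[OF assms(2)]] by simp

section \<open>Embeddings of number fields\<close>

lemma field_embedding_simps:
  assumes "field_embedding f"
  shows "f 0 = 0" "f 1 = 1" "f (x + y) = f x + f y" "f (x * y) = f x * f y" "f (- x) = - f x"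
    "f (x - y) = f x - f y"
proof -
  show a: "f 1 = 1" "\<And>x y. f (x + y) = f x + f y" "f (x * y) = f x * f y"
    using assms by (auto simp: field_embedding_def)
  show z: "f 0 = 0" using a(2)[of 0 0] by (metis add_cancel_right_right)
  have m: "f (- x) = - f x" for x using a(2)[of x "- x"] z by (simp add: eq_neg_iff_add_eq_0 add.commute)
  show "f (- x) = - f x" by (rule m)
  show "f (x - y) = f x - f y" using a(2)[of x "- y"] m by simp
qed

lemma field_embedding_of_nat: "field_embedding f \<Longrightarrow> f (of_nat n) = of_nat n"
  by (induction n) (simp_all add: field_embedding_simps)

lemma field_embedding_eq_0_iff: "field_embedding f \<Longrightarrow> f x = 0 \<longleftrightarrow> x = 0"
proof (cases "x = 0")
  case False
  assume f: "field_embedding f"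
  have "f x * f (inverse x) = 1"
    using False field_embedding_simps(4)[OF f, of x "inverse x"] by (simp add: field_embedding_simps[OF f])
  then show ?thesis using False by auto
qed (simp add: field_embedding_simps)

lemma field_embedding_inj: "field_embedding f \<Longrightarrow> inj f"
  using field_embedding_eq_0_iff[of f "_ - _"] by (intro injI) (simp add: field_embedding_simps)

text \<open>Dedekind's independence of characters: if a relation has two nonzero coefficients, combining
  its values at \<open>x y\<close> with its values at \<open>y\<close> multiplied by \<open>e i x\<close> removes the \<open>i\<close>-th term.\<close>

lemma embeddings_independent:
  fixes e :: "'i \<Rightarrow> 'k::field \<Rightarrow> 'l::field"
  assumes "finite I" and "\<And>i. i \<in> I \<Longrightarrow> field_embedding (e i)" and "inj_on e I"
    and "\<And>x. (\<Sum>i\<in>I. c i * e i x) = 0" and "i \<in> I"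
  shows "c i = 0"
  using assms
proof (induction I arbitrary: c i rule: finite_induct)
  case (insert j I)
  have vanish: "c i = 0" if "i \<in> I" for i
  proof -
    have "e i \<noteq> e j" using insert.prems(2) insert.hyps that by (metis inj_on_def insertCI)
    then obtain x where x: "e i x \<noteq> e j x" by blast
    have "(\<Sum>i\<in>I. (c i * (e i x - e j x)) * e i y) = 0" for y
    proof -
      have "(\<Sum>i\<in>insert j I. c i * e i (x * y)) - e j x * (\<Sum>i\<in>insert j I. c i * e i y)
          = (\<Sum>i\<in>insert j I. (c i * (e i x - e j x)) * e i y)"
        unfolding sum_distrib_left sum_subtractf[symmetric]
        by (intro sum.cong refl) (simp add: insert.prems(1) field_embedding_simps algebra_simps)
      also have "\<dots> = (\<Sum>i\<in>I. (c i * (e i x - e j x)) * e i y)"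
        using insert.hyps by simp
      finally show ?thesis using insert.prems(3) by simp
    qed
    then have "c i * (e i x - e j x) = 0"
      using insert.prems that
      by (intro insert.IH[where c = "\<lambda>i. c i * (e i x - e j x)"]) (simp_all add: inj_on_def)
    then show ?thesis using x by simp
  qed
  then have "c j * e j 1 = 0" using insert.prems(3)[of 1] insert.hyps by simp
  then have "c j = 0" using insert.prems(1)[of j] by (simp add: field_embedding_simps)
  then show ?case using vanish insert.prems(4) by blast
qed simp

text \<open>The exponents up to \<open>card B\<close> are one more than the spanning elements, so
  the powers of \<open>x\<close> satisfy a nontrivial rational relation.\<close>

lemma number_field_algebraic:
  fixes x :: "'k::field_char_0"
  assumes "number_field TYPE('k)"
  shows "algebraic x"
proof -
  interpret Q: vector_space "\<lambda>(q::rat) x::'k. of_rat q * x"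
    by unfold_locales (simp_all add: algebra_simps of_rat_add of_rat_mult)
  obtain B :: "'k set" where B: "finite B" "Q.span B = UNIV"
    using assms unfolding number_field_def by blast
  show ?thesis
  \<comment> \<open>Linear dependence is a property of sets, so a coincidence between two powers has
    to be treated on its own.\<close>
  proof (cases "inj_on (\<lambda>i. x ^ i) {..card B}")
    case False
    then obtain i j where ij: "i < j" "x ^ i = x ^ j"
      unfolding inj_on_def by (auto dest: neq_iff[THEN iffD1])
    let ?p = "monom 1 j - monom 1 i :: 'k poly"
    have "coeff ?p j = 1" using ij by simp
    then have "?p \<noteq> 0" by (metis coeff_0 zero_neq_one)
    moreover have "coeff ?p k \<in> \<rat>" for k by simp
    moreover have "poly ?p x = 0" using ij by (simp add: poly_monom)
    ultimately show ?thesis using algebraicI'[of ?p x] by blast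
  next
    case True
    let ?S = "(\<lambda>i. x ^ i) ` {..card B}"
    have "card ?S = Suc (card B)" using True by (simp add: card_image)
    then have "Q.dependent ?S"
      using Q.independent_span_bound[of B ?S] B by fastforce
    then obtain u where u: "\<exists>v\<in>?S. u v \<noteq> 0" "(\<Sum>v\<in>?S. of_rat (u v) * v) = 0"
      using Q.dependent_finite[of ?S] by auto
    define p where "p = (\<Sum>i\<le>card B. monom (of_rat (u (x ^ i)) :: 'k) i)"
    have c: "coeff p k = (if k \<le> card B then of_rat (u (x ^ k)) else 0)" for k
    proof -
      have "coeff p k = (\<Sum>i\<le>card B. if i = k then of_rat (u (x ^ i)) else 0)"
        by (simp add: p_def coeff_sum)
      then show ?thesis by (simp add: sum.delta)
    qed
    have "poly p x = 0"
      using u(2) True by (simp add: p_def poly_sum poly_monom sum.reindex)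
    moreover have "p \<noteq> 0"
    proof -
      obtain k where "k \<le> card B" "u (x ^ k) \<noteq> 0" using u(1) by auto
      then have "coeff p k \<noteq> 0" by (simp add: c)
      then show ?thesis by auto
    qed
    moreover have "coeff p k \<in> \<rat>" for k by (simp add: c)
    ultimately show ?thesis using algebraicI'[of p x] by blast
  qed
qed

text \<open>Clearing the leading coefficient \<open>a\<close>: multiplied by
  \<open>a ^ (d - 1)\<close>, the equation for \<open>x\<close> becomes a monic integral equation
  \<open>q\<close> for \<open>a * x\<close>.\<close>

lemma algebraic_multiple_algebraic_int:
  fixes x :: "'k::field_char_0"
  assumes "algebraic x"
  obtains n :: nat where "n > 0" "algebraic_int (of_nat n * x)"
proof -
  obtain p :: "int poly" where p: "p \<noteq> 0" "poly (map_poly of_int p) x = 0"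
    using assms by (metis algebraicE'_nonzero algebraic_0 algebraicE')
  define d where "d = degree p"
  define a where "a = lead_coeff p"
  have a0: "a \<noteq> 0" using p by (simp add: a_def)
  have dpos: "d > 0"
  proof (rule ccontr)
    assume "\<not> d > 0"
    then obtain c where "p = [:c:]" by (auto simp: d_def elim: degree_eq_zeroE)
    then show False using p by simp
  qed
  define q where "q = (\<Sum>k<d. monom (coeff p k * a ^ (d - 1 - k)) k) + monom 1 d"
  have cq: "coeff q k = (if k < d then coeff p k * a ^ (d - 1 - k) else if k = d then 1 else 0)" for k
  proof -
    have "coeff q k = (\<Sum>i<d. if i = k then coeff p i * a ^ (d - 1 - i) else 0) + (if d = k then 1 else 0)"
      by (simp add: q_def coeff_sum)
    then show ?thesis by (simp add: sum.delta)
  qed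
  have "degree q = d"
    by (rule antisym[OF degree_le le_degree]) (auto simp: cq)
  then have lead: "lead_coeff q = 1" by (simp add: cq)
  have "poly (map_poly of_int q) (of_int a * x)
      = (\<Sum>k\<le>d. of_int (coeff q k) * (of_int a * x) ^ k)"
    by (simp add: poly_altdef \<open>degree q = d\<close> degree_map_poly coeff_map_poly)
  also have "\<dots> = (\<Sum>k\<le>d. of_int a ^ (d - 1) * (of_int (coeff p k) * x ^ k))"
  proof (rule sum.cong[OF refl])
    fix k assume k: "k \<in> {..d}"
    show "of_int (coeff q k) * (of_int a * x) ^ k = of_int a ^ (d - 1) * (of_int (coeff p k) * x ^ k)"
    proof (cases "k = d")
      case True
      obtain e where "d = Suc e" using dpos by (cases d) auto
      moreover have "coeff p d = a" by (simp add: a_def d_def)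
      ultimately show ?thesis using True by (simp add: cq power_mult_distrib)
    next
      case False
      then have kd: "k < d" using k by simp
      then have "of_int a ^ (d - 1 - k) * of_int a ^ k = (of_int a ^ (d - 1) :: 'k)"
        by (simp flip: power_add)
      then show ?thesis using kd by (simp add: cq power_mult_distrib algebra_simps)
    qed
  qed
  also have "\<dots> = of_int a ^ (d - 1) * poly (map_poly of_int p) x"
    by (simp add: poly_altdef d_def degree_map_poly coeff_map_poly sum_distrib_left)
  finally have ai: "algebraic_int (of_int a * x)"
    using lead p unfolding algebraic_int_altdef_ipoly by auto
  show ?thesis
  \<comment> \<open>The multiplier must be a natural number, while \<open>a\<close> may be
    negative.\<close>
  proof (cases "a > 0")
    case True
    then show ?thesis using that[of "nat a"] ai by simp
  next
    case False
    then show ?thesis using that[of "nat (- a)"] ai a0 algebraic_int_minus[OF ai]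
      by (simp add: of_nat_nat)
  qed
qed

section \<open>Fields of linear and bilinear forms\<close>

lemma linear_basis_expansion:
  fixes \<alpha> :: "'e::euclidean_space \<Rightarrow> 'c::real_vector"
  assumes "linear \<alpha>"
  shows "\<alpha> v = (\<Sum>b\<in>Basis. (v \<bullet> b) *\<^sub>R \<alpha> b)"
  by (subst euclidean_representation[of v, symmetric])
    (simp add: linear_sum[OF assms] linear_scale[OF assms])

lemma bilinear_basis_expansion:
  fixes \<beta> :: "'a::euclidean_space \<Rightarrow> 'b::euclidean_space \<Rightarrow> 'c::real_vector"
  assumes "bilinear \<beta>"
  shows "\<beta> u v = (\<Sum>i\<in>Basis. \<Sum>j\<in>Basis. ((u \<bullet> i) * (v \<bullet> j)) *\<^sub>R \<beta> i j)"
proof -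
  have "\<beta> u v = \<beta> (\<Sum>i\<in>Basis. (u \<bullet> i) *\<^sub>R i) (\<Sum>j\<in>Basis. (v \<bullet> j) *\<^sub>R j)"
    by (simp add: euclidean_representation)
  also have "\<dots> = (\<Sum>(i, j)\<in>Basis \<times> Basis. \<beta> ((u \<bullet> i) *\<^sub>R i) ((v \<bullet> j) *\<^sub>R j))"
    by (rule bilinear_sum[OF assms])
  finally show ?thesis
    by (simp add: sum.cartesian_product bilinear_lmul[OF assms] bilinear_rmul[OF assms] mult.commute)
qed

text \<open>Regularity is known only for fixed arguments. Expansion in the basis turns the joint
  dependence on the point and the arguments into a finite sum of products; the next three lemmas use
  the same device.\<close>

lemma continuous_on_bilinear_field:
  fixes \<beta> :: "'e::euclidean_space \<Rightarrow> 'e \<Rightarrow> 'e \<Rightarrow> 'c::real_normed_vector"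
  assumes "\<And>x. bilinear (\<beta> x)" "\<And>u v. continuous_on UNIV (\<lambda>x. \<beta> x u v)"
    and "continuous_on S f" "continuous_on S a" "continuous_on S b"
  shows "continuous_on S (\<lambda>s. \<beta> (f s) (a s) (b s))"
proof -
  have "(\<lambda>s. \<beta> (f s) (a s) (b s))
      = (\<lambda>s. \<Sum>i\<in>Basis. \<Sum>j\<in>Basis. ((a s \<bullet> i) * (b s \<bullet> j)) *\<^sub>R \<beta> (f s) i j)"
    by (intro ext bilinear_basis_expansion assms)
  then show ?thesis
    by (simp only:) (intro continuous_intros assms(3-5) continuous_on_compose2[OF assms(2)], auto)
qed

lemma continuous_on_linear_field:
  fixes \<alpha> :: "'e::euclidean_space \<Rightarrow> 'e \<Rightarrow> 'c::real_normed_vector"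
  assumes "\<And>x. linear (\<alpha> x)" "\<And>v. continuous_on UNIV (\<lambda>x. \<alpha> x v)"
    and "continuous_on S f" "continuous_on S a"
  shows "continuous_on S (\<lambda>s. \<alpha> (f s) (a s))"
proof -
  have "(\<lambda>s. \<alpha> (f s) (a s)) = (\<lambda>s. \<Sum>i\<in>Basis. (a s \<bullet> i) *\<^sub>R \<alpha> (f s) i)"
    by (intro ext linear_basis_expansion assms)
  then show ?thesis
    by (simp only:) (intro continuous_intros assms(3-4) continuous_on_compose2[OF assms(2)], auto)
qed

lemma linear_field_has_derivative:
  fixes \<alpha> :: "'e::euclidean_space \<Rightarrow> 'e \<Rightarrow> real" and f a :: "'s::real_normed_vector \<Rightarrow> 'e"
  assumes "\<And>x. linear (\<alpha> x)" and a': "\<And>w. linear (\<alpha>' w)"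
    and d: "\<And>v. ((\<lambda>x. \<alpha> x v) has_derivative (\<lambda>w. \<alpha>' w v)) (at (f s))"
    and fa: "(f has_derivative f') (at s)" "(a has_derivative a') (at s)"
  shows "((\<lambda>s. \<alpha> (f s) (a s)) has_derivative (\<lambda>h. \<alpha>' (f' h) (a s) + \<alpha> (f s) (a' h))) (at s)"
proof -
  have "((\<lambda>s. \<Sum>i\<in>Basis. (a s \<bullet> i) *\<^sub>R \<alpha> (f s) i) has_derivative
     (\<lambda>h. \<Sum>i\<in>Basis. (a s \<bullet> i) *\<^sub>R \<alpha>' (f' h) i + (a' h \<bullet> i) *\<^sub>R \<alpha> (f s) i)) (at s)"
    by (intro has_derivative_sum has_derivative_scaleR has_derivative_inner_left
       fa has_derivative_compose[OF fa(1) d])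
  moreover have "(\<lambda>h. \<Sum>i\<in>Basis. (a s \<bullet> i) *\<^sub>R \<alpha>' (f' h) i + (a' h \<bullet> i) *\<^sub>R \<alpha> (f s) i)
     = (\<lambda>h. \<alpha>' (f' h) (a s) + \<alpha> (f s) (a' h))"
  proof
    fix h
    show "(\<Sum>i\<in>Basis. (a s \<bullet> i) *\<^sub>R \<alpha>' (f' h) i + (a' h \<bullet> i) *\<^sub>R \<alpha> (f s) i)
      = \<alpha>' (f' h) (a s) + \<alpha> (f s) (a' h)"
      using linear_basis_expansion[OF a', of "f' h" "a s"]
        linear_basis_expansion[OF assms(1), of "f s" "a' h"]
      by (simp add: sum.distrib)
  qed
  moreover have "(\<lambda>s. \<alpha> (f s) (a s)) = (\<lambda>s. \<Sum>i\<in>Basis. (a s \<bullet> i) *\<^sub>R \<alpha> (f s) i)"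
    by (intro ext linear_basis_expansion assms)
  ultimately show ?thesis by simp
qed

lemma bilinear_field_has_derivative:
  fixes \<beta> :: "'e::euclidean_space \<Rightarrow> 'e \<Rightarrow> 'e \<Rightarrow> real" and f a b :: "'s::real_normed_vector \<Rightarrow> 'e"
  assumes "\<And>x. bilinear (\<beta> x)" and b': "\<And>w. bilinear (\<beta>' w)"
    and d: "\<And>u v. ((\<lambda>x. \<beta> x u v) has_derivative (\<lambda>w. \<beta>' w u v)) (at (f s))"
    and fab: "(f has_derivative f') (at s)" "(a has_derivative a') (at s)" "(b has_derivative b') (at s)"
  shows "((\<lambda>s. \<beta> (f s) (a s) (b s)) has_derivative
      (\<lambda>h. \<beta>' (f' h) (a s) (b s) + \<beta> (f s) (a' h) (b s) + \<beta> (f s) (a s) (b' h))) (at s)"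
proof -
  have "((\<lambda>s. \<Sum>i\<in>Basis. \<Sum>j\<in>Basis. ((a s \<bullet> i) * (b s \<bullet> j)) *\<^sub>R \<beta> (f s) i j) has_derivative
     (\<lambda>h. \<Sum>i\<in>Basis. \<Sum>j\<in>Basis. ((a s \<bullet> i) * (b s \<bullet> j)) *\<^sub>R \<beta>' (f' h) i j
        + ((a s \<bullet> i) * (b' h \<bullet> j) + (a' h \<bullet> i) * (b s \<bullet> j)) *\<^sub>R \<beta> (f s) i j)) (at s)"
    by (intro has_derivative_sum has_derivative_scaleR has_derivative_mult has_derivative_inner_left
       fab has_derivative_compose[OF fab(1) d])
  moreover have "(\<lambda>h. \<Sum>i\<in>Basis. \<Sum>j\<in>Basis. ((a s \<bullet> i) * (b s \<bullet> j)) *\<^sub>R \<beta>' (f' h) i j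
        + ((a s \<bullet> i) * (b' h \<bullet> j) + (a' h \<bullet> i) * (b s \<bullet> j)) *\<^sub>R \<beta> (f s) i j)
     = (\<lambda>h. \<beta>' (f' h) (a s) (b s) + \<beta> (f s) (a' h) (b s) + \<beta> (f s) (a s) (b' h))"
  proof
    fix h
    show "(\<Sum>i\<in>Basis. \<Sum>j\<in>Basis. ((a s \<bullet> i) * (b s \<bullet> j)) *\<^sub>R \<beta>' (f' h) i j
        + ((a s \<bullet> i) * (b' h \<bullet> j) + (a' h \<bullet> i) * (b s \<bullet> j)) *\<^sub>R \<beta> (f s) i j)
      = \<beta>' (f' h) (a s) (b s) + \<beta> (f s) (a' h) (b s) + \<beta> (f s) (a s) (b' h)"
      using bilinear_basis_expansion[OF b', of "f' h" "a s" "b s"]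
        bilinear_basis_expansion[OF assms(1), of "f s" "a' h" "b s"]
        bilinear_basis_expansion[OF assms(1), of "f s" "a s" "b' h"]
      by (simp add: sum.distrib distrib_right)
  qed
  moreover have "(\<lambda>s. \<beta> (f s) (a s) (b s))
      = (\<lambda>s. \<Sum>i\<in>Basis. \<Sum>j\<in>Basis. ((a s \<bullet> i) * (b s \<bullet> j)) *\<^sub>R \<beta> (f s) i j)"
    by (intro ext bilinear_basis_expansion assms)
  ultimately show ?thesis by simp
qed

text \<open>The musical isomorphism, with covectors identified with vectors through the Euclidean
  inner product.\<close>

definition flat :: "('e::euclidean_space \<Rightarrow> 'e \<Rightarrow> real) \<Rightarrow> 'e \<Rightarrow> 'e" where
  "flat \<beta> z = (\<Sum>b\<in>Basis. \<beta> z b *\<^sub>R b)"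

lemma flat_inner:
  assumes "bilinear \<beta>"
  shows "flat \<beta> z \<bullet> v = \<beta> z v"
proof -
  have "linear (\<beta> z)" using assms by (auto simp: bilinear_def)
  from linear_basis_expansion[OF this, of v] show ?thesis
    by (subst inner_commute) (simp add: flat_def inner_sum_right mult.commute)
qed

lemma linear_flat: "bilinear \<beta> \<Longrightarrow> linear (flat \<beta>)"
  by (rule linearI; rule euclidean_eqI)
    (simp_all add: flat_inner inner_add_left bilinear_ladd bilinear_lmul)

lemma inj_flat:
  assumes "bilinear \<beta>" "\<And>v. v \<noteq> 0 \<Longrightarrow> \<beta> v v > 0"
  shows "inj (flat \<beta>)"
  using linear_flat[OF assms(1)]
  by (subst linear_injective_0) (metis assms flat_inner inner_zero_left less_irrefl)+

lemma posdef_bilinear_represents: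
  fixes \<beta> :: "'e::euclidean_space \<Rightarrow> 'e \<Rightarrow> real"
  assumes "bilinear \<beta>" "\<And>v. v \<noteq> 0 \<Longrightarrow> \<beta> v v > 0" "linear \<alpha>"
  shows "\<exists>z. \<forall>v. \<beta> z v = \<alpha> v"
proof -
  have "surj (flat \<beta>)"
    using assms by (intro linear_inj_imp_surj linear_flat inj_flat)
  then obtain z where z: "flat \<beta> z = (\<Sum>b\<in>Basis. \<alpha> b *\<^sub>R b)" by (metis surjD)
  have "\<beta> z v = \<alpha> v" for v
    using linear_basis_expansion[OF assms(3), of v]
    by (subst flat_inner[OF assms(1), symmetric], subst inner_commute)
      (simp add: z inner_sum_right mult.commute)
  then show ?thesis by blast
qed

text \<open>A product rule in which \<open>h\<close> is merely continuous: since
  \<open>f x = 0\<close>, the error \<open>(h y - h x) * f' (y - x)\<close> is of smaller order than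
  \<open>y - x\<close>. It lifts the dual vector field from continuous to differentiable.\<close>

lemma has_derivative_mult_vanishing:
  fixes f h :: "'a::real_normed_vector \<Rightarrow> real"
  assumes f: "(f has_derivative f') (at x)" and "f x = 0" and h: "isCont h x"
  shows "((\<lambda>y. h y * f y) has_derivative (\<lambda>w. h x * f' w)) (at x)"
proof -
  interpret bounded_linear f' using f by (rule has_derivative_bounded_linear)
  obtain C where C: "\<And>w. norm (f' w) \<le> norm w * C" using bounded by blast
  have bl: "bounded_linear (\<lambda>w. h x * f' w)" by (intro bounded_linear_const_mult f[THEN has_derivative_bounded_linear])
  have lim: "((\<lambda>y. (f y - f x - f' (y - x)) /\<^sub>R norm (y - x)) \<longlongrightarrow> 0) (at x)"
    using f by (simp add: has_derivative_at_within)
  have "((\<lambda>y. \<bar>h y\<bar> * norm ((f y - f x - f' (y - x)) /\<^sub>R norm (y - x)) + \<bar>h y - h x\<bar> * C) \<longlongrightarrow> \<bar>h x\<bar> * norm (0::real) + \<bar>h x - h x\<bar> * C) (at x)"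
    by (intro tendsto_intros lim h[unfolded isCont_def])
  then have "((\<lambda>y. \<bar>h y\<bar> * norm ((f y - f x - f' (y - x)) /\<^sub>R norm (y - x)) + \<bar>h y - h x\<bar> * C) \<longlongrightarrow> 0) (at x)"
    by simp
  then have "((\<lambda>y. (h y * f y - h x * f x - h x * f' (y - x)) /\<^sub>R norm (y - x)) \<longlongrightarrow> 0) (at x)"
  proof (rule Lim_null_comparison[rotated])
    have "norm ((h y * f y - h x * f x - h x * f' (y - x)) /\<^sub>R norm (y - x))
        \<le> \<bar>h y\<bar> * norm ((f y - f x - f' (y - x)) /\<^sub>R norm (y - x)) + \<bar>h y - h x\<bar> * C" if "y \<noteq> x" for y
    proof -
      have n: "norm (y - x) > 0" using that by simp
      have "\<bar>h y * f y - h x * f' (y - x)\<bar> = \<bar>h y * (f y - f' (y - x)) + (h y - h x) * f' (y - x)\<bar>"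
        by (simp add: algebra_simps)
      also have "\<dots> \<le> \<bar>h y\<bar> * \<bar>f y - f' (y - x)\<bar> + \<bar>h y - h x\<bar> * (norm (y - x) * C)"
        using C[of "y - x"] by (intro abs_triangle_ineq[THEN order_trans] add_mono) (auto simp: abs_mult intro: mult_left_mono)
      finally have "\<bar>h y * f y - h x * f' (y - x)\<bar> / norm (y - x)
         \<le> (\<bar>h y\<bar> * \<bar>f y - f' (y - x)\<bar> + \<bar>h y - h x\<bar> * (norm (y - x) * C)) / norm (y - x)"
        by (rule divide_right_mono) simp
      also have "\<dots> = \<bar>h y\<bar> * (\<bar>f y - f' (y - x)\<bar> / norm (y - x)) + \<bar>h y - h x\<bar> * C"
        using n by (simp add: add_divide_distrib)
      finally show ?thesis using assms(2) by (simp add: divide_inverse_commute abs_mult)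
    qed
    then show "\<forall>\<^sub>F y in at x. norm ((h y * f y - h x * f x - h x * f' (y - x)) /\<^sub>R norm (y - x))
        \<le> \<bar>h y\<bar> * norm ((f y - f x - f' (y - x)) /\<^sub>R norm (y - x)) + \<bar>h y - h x\<bar> * C"
      by (auto simp: eventually_at_filter)
  qed
  then show ?thesis using bl by (simp add: has_derivative_at_within)
qed

text \<open>Uniform continuity on \<open>{0..1} \<times> C\<close>. This supplies one step size that
  serves all points of the compact set meeting every orbit.\<close>

lemma compact_uniform_limit_at_0:
  fixes q :: "real \<times> 'a::metric_space \<Rightarrow> real"
  assumes "continuous_on ({0..1} \<times> C) q" "compact C" "\<And>c. c \<in> C \<Longrightarrow> q (0, c) = k" "e > 0"
  obtains d where "0 < d" "d \<le> 1" "\<And>t c. 0 \<le> t \<Longrightarrow> t \<le> d \<Longrightarrow> c \<in> C \<Longrightarrow> \<bar>q (t, c) - k\<bar> \<le> e"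
proof -
  have "uniformly_continuous_on ({0..1} \<times> C) q"
    using assms by (intro compact_uniformly_continuous compact_Times) auto
  then obtain d where d: "d > 0" "\<And>p p'. p \<in> {0..1} \<times> C \<Longrightarrow> p' \<in> {0..1} \<times> C \<Longrightarrow> dist p' p < d \<Longrightarrow> dist (q p') (q p) < e"
    using assms(4) unfolding uniformly_continuous_on_def by metis
  show thesis
  proof (rule that[of "min 1 (d/2)"])
    fix t :: real and c assume "0 \<le> t" "t \<le> min 1 (d/2)" "c \<in> C"
    then have "dist (q (t, c)) (q (0, c)) < e"
      using d(1) by (intro d(2)) (auto simp: dist_Pair_Pair)
    then show "\<bar>q (t, c) - k\<bar> \<le> e" using assms(3) \<open>c \<in> C\<close> by (simp add: dist_real_def)
  qed (use d(1) in auto)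
qed

section \<open>Parallel one-forms invariant under a cocompact affine action\<close>

text \<open>Here \<open>\<Gamma>\<close> holds the Christoffel symbols: \<open>g_deriv\<close> and \<open>form_deriv\<close> say that \<open>g\<close> and \<open>\<theta>\<close> are
  parallel, and the symmetry of \<open>\<Gamma>\<close> makes \<open>\<theta>\<close> closed.\<close>

locale parallel_one_form_data =
  fixes g :: "'e::euclidean_space \<Rightarrow> 'e \<Rightarrow> 'e \<Rightarrow> real" and \<Gamma> :: "'e \<Rightarrow> 'e \<Rightarrow> 'e \<Rightarrow> 'e"
    and \<theta> :: "'e \<Rightarrow> 'e \<Rightarrow> real"
    and H :: "'h set" and act lin :: "'h \<Rightarrow> 'e \<Rightarrow> 'e" and K :: "'e set"
  assumes g_bilinear: "bilinear (g x)" and g_sym: "g x u v = g x v u"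
    and g_pos: "v \<noteq> 0 \<Longrightarrow> g x v v > 0"
    and g_deriv: "((\<lambda>x. g x u v) has_derivative (\<lambda>w. g x (\<Gamma> x w u) v + g x u (\<Gamma> x w v))) (at x)"
    and Christoffel_bilinear: "bilinear (\<Gamma> x)" and Christoffel_sym: "\<Gamma> x u v = \<Gamma> x v u"
    and Christoffel_cont: "continuous_on UNIV (\<lambda>x. \<Gamma> x u v)"
    and form_linear: "linear (\<theta> x)"
    and form_deriv: "((\<lambda>x. \<theta> x v) has_derivative (\<lambda>w. \<theta> x (\<Gamma> x w v))) (at x)"
    and form_nonzero: "\<exists>x v. \<theta> x v \<noteq> 0"
    and act_affine: "h \<in> H \<Longrightarrow> act h (x + v) = act h x + lin h v"
    and lin_linear: "h \<in> H \<Longrightarrow> linear (lin h)" and lin_surj: "h \<in> H \<Longrightarrow> surj (lin h)"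
    and g_invariant: "h \<in> H \<Longrightarrow> g (act h x) (lin h u) (lin h v) = g x u v"
    and form_invariant: "h \<in> H \<Longrightarrow> \<theta> (act h x) (lin h v) = \<theta> x v"
    and compact_K: "compact K" and cocompact: "\<exists>h\<in>H. act h x \<in> K"
begin

lemma g_linear: "linear (g x u)" "linear (\<lambda>u. g x u v)"
  using g_bilinear[of x] by (auto simp: bilinear_def)

lemma Christoffel_linear: "linear (\<Gamma> x u)" "linear (\<lambda>u. \<Gamma> x u v)"
  using Christoffel_bilinear[of x] by (auto simp: bilinear_def)

lemmas linear_simps = linear_add[OF g_linear(1)] linear_add[OF g_linear(2)]
  linear_scale[OF g_linear(1)] linear_scale[OF g_linear(2)]
  linear_neg[OF g_linear(1)] linear_neg[OF g_linear(2)]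
  linear_add[OF Christoffel_linear(1)] linear_add[OF Christoffel_linear(2)]
  linear_scale[OF Christoffel_linear(1)] linear_scale[OF Christoffel_linear(2)]
  linear_neg[OF Christoffel_linear(1)] linear_neg[OF Christoffel_linear(2)]
  linear_add[OF form_linear] linear_scale[OF form_linear] linear_neg[OF form_linear]
  linear_0[OF g_linear(1)] linear_0[OF g_linear(2)] linear_0[OF Christoffel_linear(1)]
  linear_0[OF Christoffel_linear(2)] linear_0[OF form_linear]

lemma g_cont: "continuous_on UNIV (\<lambda>x. g x u v)"
  by (rule continuous_at_imp_continuous_on) (use has_derivative_continuous[OF g_deriv] in blast)

lemma form_cont: "continuous_on UNIV (\<lambda>x. \<theta> x v)"
  by (rule continuous_at_imp_continuous_on) (use has_derivative_continuous[OF form_deriv] in blast)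

lemmas field_continuous_intros =
  continuous_on_bilinear_field[of g, OF g_bilinear g_cont]
  continuous_on_bilinear_field[of \<Gamma>, OF Christoffel_bilinear Christoffel_cont]
  continuous_on_linear_field[of \<theta>, OF form_linear form_cont]

section \<open>The Lee field: the metric dual of the one-form\<close>

definition lee :: "'e \<Rightarrow> 'e" where
  "lee x = (SOME z. \<forall>v. g x z v = \<theta> x v)"

lemma g_lee: "g x (lee x) v = \<theta> x v"
proof -
  have "\<exists>z. \<forall>v. g x z v = \<theta> x v"
    by (rule posdef_bilinear_represents[OF g_bilinear g_pos form_linear])
  from someI_ex[OF this] show ?thesis unfolding lee_def by blast
qed

lemma g_nondegenerate:
  assumes "\<And>v. g x z v = g x z' v"
  shows "z = z'"
proof (rule ccontr)
  assume "z \<noteq> z'"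
  then have "g x (z - z') (z - z') > 0" by (intro g_pos) simp
  moreover have "g x (z - z') (z - z') = g x z (z - z') - g x z' (z - z')"
    by (rule linear_diff[OF g_linear(2)])
  ultimately show False using assms by simp
qed

text \<open>The constant is the minimum of the metric over the compact set of Euclidean unit vectors
  at points of \<open>C\<close>; homogeneity does the rest.\<close>

lemma g_lower_bound:
  assumes "compact C"
  obtains c where "c > 0" "\<And>x v. x \<in> C \<Longrightarrow> c * (norm v)\<^sup>2 \<le> g x v v"
proof (cases "C = {}")
  case True
  then show thesis using that[of 1] by simp
next
  case False
  have "continuous_on (C \<times> sphere 0 1) (\<lambda>p. g (fst p) (snd p) (snd p))"
    by (intro field_continuous_intros continuous_intros)
  moreover have "C \<times> sphere (0::'e) 1 \<noteq> {}" using False by simp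
  moreover have "compact (C \<times> sphere (0::'e) 1)" using assms by (intro compact_Times compact_sphere)
  ultimately obtain p where p: "p \<in> C \<times> sphere 0 1"
    and min: "\<And>q. q \<in> C \<times> sphere 0 1 \<Longrightarrow> g (fst p) (snd p) (snd p) \<le> g (fst q) (snd q) (snd q)"
    using continuous_attains_inf[of "C \<times> sphere (0::'e) 1" "\<lambda>p. g (fst p) (snd p) (snd p)"] by blast
  define c where "c = g (fst p) (snd p) (snd p)"
  have "snd p \<noteq> 0" using p by auto
  then have "c > 0" unfolding c_def by (rule g_pos)
  moreover have "c * (norm v)\<^sup>2 \<le> g x v v" if "x \<in> C" for x v
  proof (cases "v = 0")
    case False
    have "c \<le> g x (v /\<^sub>R norm v) (v /\<^sub>R norm v)"
      using min[of "(x, v /\<^sub>R norm v)"] that False by (simp add: c_def)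
    then show ?thesis using False by (simp add: linear_simps field_simps power2_eq_square)
  qed (simp add: linear_simps)
  ultimately show thesis by (rule that)
qed

lemma form_upper_bound:
  assumes "compact C"
  obtains B where "B \<ge> 0" "\<And>x v. x \<in> C \<Longrightarrow> \<bar>\<theta> x v\<bar> \<le> B * norm v"
proof -
  have "continuous_on (C \<times> sphere 0 1) (\<lambda>p. \<theta> (fst p) (snd p))"
    by (intro field_continuous_intros continuous_intros)
  then have "bounded ((\<lambda>p. \<theta> (fst p) (snd p)) ` (C \<times> sphere (0::'e) 1))"
    using assms by (intro compact_imp_bounded compact_continuous_image compact_Times compact_sphere)
  then obtain B where B: "B > 0" "\<And>p. p \<in> C \<times> sphere 0 1 \<Longrightarrow> \<bar>\<theta> (fst p) (snd p)\<bar> \<le> B"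
    unfolding bounded_pos by auto
  have "\<bar>\<theta> x v\<bar> \<le> B * norm v" if "x \<in> C" for x v
  proof (cases "v = 0")
    case False
    have "\<bar>\<theta> x (v /\<^sub>R norm v)\<bar> \<le> B"
      using B(2)[of "(x, v /\<^sub>R norm v)"] that False by simp
    then show ?thesis using False by (simp add: linear_simps field_simps abs_mult)
  qed (simp add: linear_simps)
  then show thesis using that B(1) by (meson less_imp_le)
qed

text \<open>Compare both ends of \<open>c * (norm (lee x))\<^sup>2 \<le> g x (lee x) (lee x) =
  \<theta> x (lee x) \<le> B * norm (lee x)\<close>.\<close>

lemma lee_bounded:
  assumes "compact C"
  obtains B where "\<And>x. x \<in> C \<Longrightarrow> norm (lee x) \<le> B"
proof -
  obtain c where c: "c > 0" "\<And>x v. x \<in> C \<Longrightarrow> c * (norm v)\<^sup>2 \<le> g x v v"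
    using g_lower_bound[OF assms] by blast
  obtain B where B: "B \<ge> 0" "\<And>x v. x \<in> C \<Longrightarrow> \<bar>\<theta> x v\<bar> \<le> B * norm v"
    using form_upper_bound[OF assms] by blast
  have "norm (lee x) \<le> B / c" if "x \<in> C" for x
  proof (cases "lee x = 0")
    case False
    have "c * (norm (lee x))\<^sup>2 \<le> B * norm (lee x)"
      using c(2)[OF that, of "lee x"] B(2)[OF that, of "lee x"] by (simp add: g_lee)
    then show ?thesis using False c(1) by (simp add: power2_eq_square field_simps)
  qed (use B(1) c(1) in simp)
  then show thesis by (rule that)
qed

lemma flat_left_inverse:
  obtains M where "bounded_linear M" "\<And>z. M (flat (g x) z) = z"
  using linear_injective_left_inverse[OF linear_flat[OF g_bilinear] inj_flat[OF g_bilinear g_pos]]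
  by (metis comp_apply id_apply linear_conv_bounded_linear)

text \<open>The metric is frozen at \<open>x\<close> while the field moves with \<open>y\<close>.
  Every correction term is a component of the field times a factor that vanishes at
  \<open>y = x\<close>, so regularity of the field follows without inverting a varying
  matrix.\<close>

lemma g_lee_nearby:
  "g x (lee y) b = \<theta> y b - (\<Sum>i\<in>Basis. (lee y \<bullet> i) * (g y i b - g x i b))"
proof -
  have "g x z b = (\<Sum>i\<in>Basis. (z \<bullet> i) * g x i b)" for x z
    using linear_basis_expansion[OF g_linear(2)[of x b], of z] by simp
  from this[of x "lee y"] this[of y "lee y"] show ?thesis
    by (simp add: g_lee right_diff_distrib sum_subtractf)
qed

lemma isCont_lee: "isCont lee x"
proof -
  obtain B where B: "\<And>y. y \<in> cball x 1 \<Longrightarrow> norm (lee y) \<le> B"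
    using lee_bounded[OF compact_cball] by blast
  have "isCont (\<lambda>y. g x (lee y) b) x" for b
  proof -
    have "((\<lambda>y. (lee y \<bullet> i) * (g y i b - g x i b)) \<longlongrightarrow> 0) (at x)" if "i \<in> Basis" for i
    proof (rule Lim_null_comparison)
      have "eventually (\<lambda>y. y \<in> cball x 1) (at x)"
        by (auto simp: eventually_at dist_commute intro!: exI[of _ 1])
      then show "eventually (\<lambda>y. norm ((lee y \<bullet> i) * (g y i b - g x i b)) \<le> B * \<bar>g y i b - g x i b\<bar>) (at x)"
      proof eventually_elim
        case (elim y)
        have "\<bar>lee y \<bullet> i\<bar> \<le> B" using B[OF elim] Basis_le_norm[OF that, of "lee y"] by simp
        then show ?case by (simp add: abs_mult mult_right_mono)
      qed
      have "((\<lambda>y. g y i b) \<longlongrightarrow> g x i b) (at x)"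
        using g_cont[of i b] by (simp add: continuous_on_def)
      then have "((\<lambda>y. B * \<bar>g y i b - g x i b\<bar>) \<longlongrightarrow> B * \<bar>g x i b - g x i b\<bar>) (at x)"
        by (intro tendsto_intros)
      then show "((\<lambda>y. B * \<bar>g y i b - g x i b\<bar>) \<longlongrightarrow> 0) (at x)" by simp
    qed
    moreover have "((\<lambda>y. \<theta> y b) \<longlongrightarrow> \<theta> x b) (at x)"
      using form_cont[of b] by (simp add: continuous_on_def)
    ultimately have "((\<lambda>y. \<theta> y b - (\<Sum>i\<in>Basis. (lee y \<bullet> i) * (g y i b - g x i b)))
        \<longlongrightarrow> \<theta> x b - (\<Sum>i\<in>(Basis::'e set). 0)) (at x)"
      by (intro tendsto_diff tendsto_sum)
    then show ?thesis
      unfolding isCont_def by (simp add: g_lee_nearby[of x _ b] g_lee)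
  qed
  then have *: "isCont (\<lambda>y. flat (g x) (lee y)) x"
    unfolding flat_def by (intro continuous_intros)
  obtain M where M: "bounded_linear M" "\<And>z. M (flat (g x) z) = z"
    using flat_left_inverse by blast
  show ?thesis
    using bounded_linear.isCont[OF M(1) *] by (simp add: M(2))
qed

text \<open>The dual of a parallel form is parallel. In \<open>g_lee_nearby\<close> only the factors
  vanishing at \<open>x\<close> are differentiated, and the terms containing
  \<open>\<Gamma> x w b\<close> cancel against the derivative of the form.\<close>

lemma lee_has_derivative: "(lee has_derivative (\<lambda>w. - \<Gamma> x w (lee x))) (at x)"
proof -
  have *: "((\<lambda>y. g x (lee y) b) has_derivative (\<lambda>w. g x (- \<Gamma> x w (lee x)) b)) (at x)" for b
  proof -
    have "((\<lambda>y. g y i b - g x i b) has_derivative (\<lambda>w. g x (\<Gamma> x w i) b + g x i (\<Gamma> x w b))) (at x)" for i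
      using has_derivative_diff[OF g_deriv[of i b x] has_derivative_const] by simp
    then have "((\<lambda>y. (lee y \<bullet> i) * (g y i b - g x i b)) has_derivative
        (\<lambda>w. (lee x \<bullet> i) * (g x (\<Gamma> x w i) b + g x i (\<Gamma> x w b)))) (at x)" for i
      by (rule has_derivative_mult_vanishing) (auto intro!: continuous_intros isCont_lee)
    then have "((\<lambda>y. g x (lee y) b) has_derivative (\<lambda>w. \<theta> x (\<Gamma> x w b)
        - (\<Sum>i\<in>Basis. (lee x \<bullet> i) * (g x (\<Gamma> x w i) b + g x i (\<Gamma> x w b))))) (at x)"
      unfolding g_lee_nearby by (intro has_derivative_diff form_deriv has_derivative_sum)
    moreover have "\<theta> x (\<Gamma> x w b) - (\<Sum>i\<in>Basis. (lee x \<bullet> i) * (g x (\<Gamma> x w i) b + g x i (\<Gamma> x w b)))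
       = g x (- \<Gamma> x w (lee x)) b" for w
    proof -
      have "linear (\<lambda>z. g x (\<Gamma> x w z) b + g x z (\<Gamma> x w b))"
        by (rule linearI) (simp_all add: linear_simps algebra_simps)
      from linear_basis_expansion[OF this, of "lee x"] show ?thesis
        by (simp add: g_lee linear_simps)
    qed
    ultimately show ?thesis by simp
  qed
  have *: "((\<lambda>y. flat (g x) (lee y)) has_derivative (\<lambda>w. flat (g x) (- \<Gamma> x w (lee x)))) (at x)"
    unfolding flat_def by (intro has_derivative_sum has_derivative_scaleR_left *)
  obtain M where M: "bounded_linear M" "\<And>z. M (flat (g x) z) = z"
    using flat_left_inverse by blast
  show ?thesis
    using bounded_linear.has_derivative[OF M(1) *] by (simp add: M(2))
qed

lemma lee_cont: "continuous_on S lee"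
  by (simp add: continuous_at_imp_continuous_on isCont_lee)

text \<open>The value is the squared length of the Lee field; its derivative vanishes because the
  metric and the field are both parallel.\<close>

lemma form_lee_constant: obtains \<kappa> where "\<kappa> > 0" "\<And>x. \<theta> x (lee x) = \<kappa>"
proof -
  have bil: "bilinear (\<lambda>u v. g x (\<Gamma> x w u) v + g x u (\<Gamma> x w v))" for x w
    unfolding bilinear_def by (auto intro!: linearI simp: linear_simps algebra_simps)
  have "((\<lambda>x. g x (lee x) (lee x)) has_derivative (\<lambda>w. 0)) (at x)" for x
  proof -
    have *: "((\<lambda>x. g x (lee x) (lee x)) has_derivative
       (\<lambda>w. (g x (\<Gamma> x w (lee x)) (lee x) + g x (lee x) (\<Gamma> x w (lee x)))
         + g x (- \<Gamma> x w (lee x)) (lee x) + g x (lee x) (- \<Gamma> x w (lee x)))) (at x)"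
      using bilinear_field_has_derivative[of g "\<lambda>w u v. g x (\<Gamma> x w u) v + g x u (\<Gamma> x w v)" "\<lambda>x. x" x,
        OF g_bilinear bil g_deriv has_derivative_ident lee_has_derivative lee_has_derivative]
      by simp
    show ?thesis by (rule has_derivative_eq_rhs[OF *]) (simp add: linear_simps)
  qed
  then obtain \<kappa> where \<kappa>: "\<And>x. g x (lee x) (lee x) = \<kappa>"
    using has_derivative_zero_constant[of UNIV "\<lambda>x. g x (lee x) (lee x)"] by auto
  obtain x v where "\<theta> x v \<noteq> 0" using form_nonzero by blast
  then have "lee x \<noteq> 0" using g_lee[of x v] by (auto simp: linear_simps)
  then have "\<kappa> > 0" using g_pos[of "lee x" x] \<kappa> by simp
  then show thesis using that \<kappa> by (simp add: g_lee)
qed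

lemma lee_equivariant:
  assumes h: "h \<in> H"
  shows "lee (act h x) = lin h (lee x)"
proof (rule g_nondegenerate)
  fix v
  obtain w where w: "v = lin h w" using lin_surj[OF h] by (metis surjD)
  show "g (act h x) (lee (act h x)) v = g (act h x) (lin h (lee x)) v"
    unfolding w by (simp add: g_lee g_invariant[OF h] form_invariant[OF h])
qed

lemma act_has_derivative:
  assumes h: "h \<in> H"
  shows "(act h has_derivative lin h) (at x)"
proof -
  have "act h y = act h 0 + lin h y" for y using act_affine[OF h, of 0 y] by simp
  then have "act h = (\<lambda>y. act h 0 + lin h y)" by blast
  moreover have "((\<lambda>y. act h 0 + lin h y) has_derivative lin h) (at x)"
    using lin_linear[OF h] by (auto intro!: derivative_eq_intros linear_imp_has_derivative)
  ultimately show ?thesis by simp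
qed

text \<open>The locale does not state how \<open>\<Gamma>\<close> transforms under
  \<open>act\<close>. Differentiating \<open>lee_equivariant\<close> gives the one instance that the
  derivative of an Euler step needs.\<close>

lemma lee_derivative_equivariant:
  assumes h: "h \<in> H"
  shows "\<Gamma> (act h x) (lin h w) (lee (act h x)) = lin h (\<Gamma> x w (lee x))"
proof -
  have 1: "((\<lambda>y. lee (act h y)) has_derivative (\<lambda>w. - \<Gamma> (act h x) (lin h w) (lee (act h x)))) (at x)"
    by (rule has_derivative_compose[OF act_has_derivative[OF h] lee_has_derivative])
  have "((\<lambda>y. lin h (lee y)) has_derivative (\<lambda>w. lin h (- \<Gamma> x w (lee x)))) (at x)"
    using bounded_linear.has_derivative[OF _ lee_has_derivative] lin_linear[OF h]
    by (simp add: linear_conv_bounded_linear)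
  then have 2: "((\<lambda>y. lee (act h y)) has_derivative (\<lambda>w. lin h (- \<Gamma> x w (lee x)))) (at x)"
    by (simp add: lee_equivariant[OF h])
  from has_derivative_unique[OF 1 2] have "- \<Gamma> (act h x) (lin h w) (lee (act h x)) = lin h (- \<Gamma> x w (lee x))"
    by meson
  then show ?thesis using linear_neg[OF lin_linear[OF h]] by simp
qed

section \<open>Euler steps along the Lee field\<close>

definition euler :: "real \<Rightarrow> 'e \<Rightarrow> 'e" where
  "euler t x = x + t *\<^sub>R lee x"

definition deuler :: "real \<Rightarrow> 'e \<Rightarrow> 'e \<Rightarrow> 'e" where
  "deuler t x v = v - t *\<^sub>R \<Gamma> x v (lee x)"

lemma euler_has_derivative: "(euler t has_derivative deuler t x) (at x)"
  unfolding euler_def[abs_def] deuler_def[abs_def]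
  by (auto intro!: derivative_eq_intros lee_has_derivative)

lemma euler_equivariant: "h \<in> H \<Longrightarrow> euler t (act h x) = act h (euler t x)"
  by (simp add: euler_def lee_equivariant act_affine linear_scale[OF lin_linear])

lemma deuler_equivariant: "h \<in> H \<Longrightarrow> deuler t (act h x) (lin h v) = lin h (deuler t x v)"
  by (simp add: deuler_def lee_derivative_equivariant linear_diff[OF lin_linear] linear_scale[OF lin_linear])

lemma linear_deuler: "linear (deuler t x)"
  using euler_has_derivative has_derivative_linear by blast

text \<open>The derivative in \<open>t\<close> of the length below vanishes at \<open>t = 0\<close>, because the Lee field is Killing.\<close>

lemma euler_length_has_derivative:
  "((\<lambda>t. g (euler t x) (deuler t x v) (deuler t x v)) has_real_derivative
      2 * g (euler t x) (\<Gamma> (euler t x) (lee x) (deuler t x v)) (deuler t x v)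
      - 2 * g (euler t x) (\<Gamma> x v (lee x)) (deuler t x v)) (at t)"
proof -
  have bil: "bilinear (\<lambda>u v. g y (\<Gamma> y w u) v + g y u (\<Gamma> y w v))" for y w
    unfolding bilinear_def by (auto intro!: linearI simp: linear_simps algebra_simps)
  have 1: "((\<lambda>t. euler t x) has_derivative (\<lambda>h. h *\<^sub>R lee x)) (at t)"
    unfolding euler_def[abs_def] by (auto intro!: derivative_eq_intros)
  have 2: "((\<lambda>t. deuler t x v) has_derivative (\<lambda>h. - (h *\<^sub>R \<Gamma> x v (lee x)))) (at t)"
    unfolding deuler_def[abs_def] by (auto intro!: derivative_eq_intros)
  have "((\<lambda>t. g (euler t x) (deuler t x v) (deuler t x v)) has_derivative
     (\<lambda>h. (g (euler t x) (\<Gamma> (euler t x) (h *\<^sub>R lee x) (deuler t x v)) (deuler t x v)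
        + g (euler t x) (deuler t x v) (\<Gamma> (euler t x) (h *\<^sub>R lee x) (deuler t x v)))
       + g (euler t x) (- (h *\<^sub>R \<Gamma> x v (lee x))) (deuler t x v)
       + g (euler t x) (deuler t x v) (- (h *\<^sub>R \<Gamma> x v (lee x))))) (at t)"
    using bilinear_field_has_derivative[OF g_bilinear bil[of "euler t x"] g_deriv 1 2 2] .
  then show ?thesis
    unfolding has_field_derivative_def
    by (rule has_derivative_eq_rhs)
      (auto simp: linear_simps g_sym[of _ "deuler t x v"] algebra_simps)
qed

text \<open>By the mean value theorem the squared length changes by \<open>t\<close> times a value
  of \<open>q\<close>, which is continuous and vanishes at \<open>t = 0\<close>. Compactness makes
  this uniform over unit vectors at points of \<open>K\<close>; scaling and the action extend it to
  all vectors and all points.\<close>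

lemma euler_almost_isometry:
  assumes "\<epsilon> > 0"
  obtains t0 where "t0 > 0" "\<And>t x v. 0 \<le> t \<Longrightarrow> t \<le> t0 \<Longrightarrow>
     g (euler t x) (deuler t x v) (deuler t x v) \<le> (1 + \<epsilon> * t) * g x v v"
proof -
  obtain c where c: "c > 0" "\<And>x v. x \<in> K \<Longrightarrow> c * (norm v)\<^sup>2 \<le> g x v v"
    using g_lower_bound[OF compact_K] by blast
  define q where "q = (\<lambda>(t, x, v). 2 * g (euler t x) (\<Gamma> (euler t x) (lee x) (deuler t x v)) (deuler t x v)
      - 2 * g (euler t x) (\<Gamma> x v (lee x)) (deuler t x v))"
  have "continuous_on ({0..1} \<times> (K \<times> sphere 0 1)) q"
    unfolding q_def split_beta euler_def deuler_def
    by (intro field_continuous_intros continuous_intros continuous_on_compose2[OF lee_cont[of UNIV]]) auto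
  moreover have "compact (K \<times> sphere (0::'e) 1)"
    using compact_K by (intro compact_Times compact_sphere)
  \<comment> \<open>The Killing equation: at time 0 the two terms of \<open>q\<close> differ only by
    exchanging the arguments of \<open>\<Gamma>\<close>.\<close>
  moreover have "q (0, p) = 0" if "p \<in> K \<times> sphere 0 1" for p
    by (cases p) (simp add: q_def euler_def deuler_def Christoffel_sym)
  \<comment> \<open>With tolerance \<open>\<epsilon> * c\<close> the absolute error on unit vectors
    becomes a relative one, since \<open>c\<close> bounds their squared length from below.\<close>
  moreover have "\<epsilon> * c > 0" using assms c(1) by simp
  ultimately obtain t0 where t0: "0 < t0" "t0 \<le> 1"
    and q: "\<And>t p. 0 \<le> t \<Longrightarrow> t \<le> t0 \<Longrightarrow> p \<in> K \<times> sphere 0 1 \<Longrightarrow> \<bar>q (t, p) - 0\<bar> \<le> \<epsilon> * c"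
    using compact_uniform_limit_at_0[of "K \<times> sphere 0 1" q 0 "\<epsilon> * c"] by metis
  have unit: "g (euler t x) (deuler t x v) (deuler t x v) \<le> (1 + \<epsilon> * t) * g x v v"
    if t: "0 \<le> t" "t \<le> t0" and x: "x \<in> K" and v: "norm v = 1" for t x v
  proof (cases "t = 0")
    case False
    then have "t > 0" using t by simp
    from MVT2[OF this euler_length_has_derivative]
    obtain z where z: "0 < z" "z < t"
      and eq: "g (euler t x) (deuler t x v) (deuler t x v) - g (euler 0 x) (deuler 0 x v) (deuler 0 x v) = (t - 0) * q (z, x, v)"
      unfolding q_def by auto
    have "q (z, x, v) \<le> \<epsilon> * c" using q[of z "(x, v)"] z t x v by auto
    also have "\<dots> \<le> \<epsilon> * g x v v" using c(2)[OF x, of v] v assms by simp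
    finally have "t * q (z, x, v) \<le> t * (\<epsilon> * g x v v)" using t(1) by (rule mult_left_mono)
    then show ?thesis using eq by (simp add: euler_def deuler_def algebra_simps)
  qed (simp add: euler_def deuler_def)
  have inK: "g (euler t x) (deuler t x v) (deuler t x v) \<le> (1 + \<epsilon> * t) * g x v v"
    if t: "0 \<le> t" "t \<le> t0" and x: "x \<in> K" for t x v
  proof (cases "v = 0")
    case False
    have "g (euler t x) (deuler t x (v /\<^sub>R norm v)) (deuler t x (v /\<^sub>R norm v)) \<le> (1 + \<epsilon> * t) * g x (v /\<^sub>R norm v) (v /\<^sub>R norm v)"
      using False by (intro unit t x) simp
    then show ?thesis using False
      by (simp add: linear_simps linear_scale[OF linear_deuler] divide_simps mult.assoc)
  qed (simp add: linear_simps linear_0[OF linear_deuler])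
  have "g (euler t x) (deuler t x v) (deuler t x v) \<le> (1 + \<epsilon> * t) * g x v v"
    if t: "0 \<le> t" "t \<le> t0" for t x v
  proof -
    obtain h where h: "h \<in> H" "act h x \<in> K" using cocompact by blast
    from inK[OF t h(2), of "lin h v"] show ?thesis
      by (simp add: euler_equivariant[OF h(1)] deuler_equivariant[OF h(1)] g_invariant[OF h(1)])
  qed
  then show thesis using that t0(1) by blast
qed

section \<open>The Poincare lemma: a primitive of the one-form and its periods\<close>

definition primitive :: "'e \<Rightarrow> real" where
  "primitive x = integral {0..1} (\<lambda>t. \<theta> (t *\<^sub>R x) x)"

lemma primitive_line_derivative:
  "((\<lambda>s. primitive (x + s *\<^sub>R w)) has_real_derivative \<theta> (x + s *\<^sub>R w) w) (at s)"
proof -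
  define y where "y s = x + s *\<^sub>R w" for s :: real
  \<comment> \<open>\<open>F s t\<close> is both the derivative in \<open>s\<close> of the integrand
    \<open>\<theta> (t *\<^sub>R y s) (y s)\<close> and the derivative in \<open>t\<close> of
    \<open>t * \<theta> (t *\<^sub>R y s) w\<close>. The two agree because \<open>\<theta>\<close>
    is closed, which is the symmetry of \<open>\<Gamma>\<close>; so the integral of
    \<open>F s\<close> telescopes.\<close>
  define F where "F s t = \<theta> (t *\<^sub>R y s) w + t * \<theta> (t *\<^sub>R y s) (\<Gamma> (t *\<^sub>R y s) (y s) w)" for s t
  have lin: "linear (\<lambda>v. \<theta> z (\<Gamma> z u v))" for z u
    by (rule linearI) (simp_all add: linear_simps)
  have y: "((\<lambda>s. y s) has_derivative (\<lambda>h. h *\<^sub>R w)) (at s)" for s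
    unfolding y_def by (auto intro!: derivative_eq_intros)
  have ycont: "continuous_on S (\<lambda>p. y (f p))" if "continuous_on S f" for S and f :: "'x::topological_space \<Rightarrow> real"
    unfolding y_def by (intro continuous_intros that)
  have "((\<lambda>s. integral (cbox 0 1) (\<lambda>t. \<theta> (t *\<^sub>R y s) (y s))) has_field_derivative integral (cbox 0 1) (F s)) (at s within UNIV)"
  proof (rule leibniz_rule_field_derivative)
    fix s t :: real
    have ty: "((\<lambda>s. t *\<^sub>R y s) has_derivative (\<lambda>h. t *\<^sub>R h *\<^sub>R w)) (at s)"
      by (auto intro!: derivative_eq_intros y)
    have "((\<lambda>s. \<theta> (t *\<^sub>R y s) (y s)) has_derivative (\<lambda>h. \<theta> (t *\<^sub>R y s) (\<Gamma> (t *\<^sub>R y s) (t *\<^sub>R h *\<^sub>R w) (y s)) + \<theta> (t *\<^sub>R y s) (h *\<^sub>R w))) (at s)"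
      using linear_field_has_derivative[OF form_linear lin[of "t *\<^sub>R y s"] form_deriv ty y] .
    then show "((\<lambda>s. \<theta> (t *\<^sub>R y s) (y s)) has_field_derivative F s t) (at s within UNIV)"
      unfolding has_field_derivative_def F_def
      by (rule has_derivative_eq_rhs) (auto simp: linear_simps Christoffel_sym[of _ w] algebra_simps)
  next
    show "(\<lambda>t. \<theta> (t *\<^sub>R y s) (y s)) integrable_on cbox 0 1" for s
      by (intro integrable_continuous field_continuous_intros continuous_intros)
    show "continuous_on (UNIV \<times> cbox 0 1) (\<lambda>(s, t). F s t)"
      unfolding F_def split_beta by (intro field_continuous_intros continuous_intros ycont)
  qed auto
  moreover have "(F s has_integral (1 * \<theta> (1 *\<^sub>R y s) w - 0 * \<theta> (0 *\<^sub>R y s) w)) {0..1}"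
  proof (rule fundamental_theorem_of_calculus)
    fix t :: real
    have "((\<lambda>t. \<theta> (t *\<^sub>R y s) w) has_derivative (\<lambda>h. \<theta> (t *\<^sub>R y s) (\<Gamma> (t *\<^sub>R y s) (h *\<^sub>R y s) w))) (at t)"
      by (rule has_derivative_compose[OF _ form_deriv]) (auto intro!: derivative_eq_intros)
    then have "((\<lambda>t. t * \<theta> (t *\<^sub>R y s) w) has_real_derivative F s t) (at t)"
      unfolding has_field_derivative_def F_def
      by (rule has_derivative_eq_rhs[OF has_derivative_mult[OF has_derivative_ident]])
        (auto simp: linear_simps algebra_simps)
    then show "((\<lambda>t. t * \<theta> (t *\<^sub>R y s) w) has_vector_derivative F s t) (at t within {0..1})"
      by (simp add: has_real_derivative_iff_has_vector_derivative has_vector_derivative_at_within)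
  qed simp
  then have "integral (cbox 0 1) (F s) = \<theta> (y s) w" by (simp add: integral_unique)
  ultimately show ?thesis by (simp add: primitive_def y_def)
qed

text \<open>Invariance of the form gives both primitives the same derivative along the segment from
  0 to \<open>x\<close>. The resulting constant is the period of \<open>h\<close>.\<close>

lemma primitive_act:
  assumes h: "h \<in> H"
  shows "primitive (act h x) - primitive x = primitive (act h 0) - primitive 0"
proof -
  have "((\<lambda>s. primitive (act h 0 + s *\<^sub>R lin h x) - primitive (0 + s *\<^sub>R x)) has_real_derivative 0) (at s)" for s
    using DERIV_diff[OF primitive_line_derivative[of "act h 0" "lin h x" s] primitive_line_derivative[of 0 x s]]
    using form_invariant[OF h, of "s *\<^sub>R x" x] act_affine[OF h, of 0 "s *\<^sub>R x"] linear_scale[OF lin_linear[OF h]]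
    by simp
  then have "primitive (act h 0 + 1 *\<^sub>R lin h x) - primitive (0 + 1 *\<^sub>R x) = primitive (act h 0 + 0 *\<^sub>R lin h x) - primitive (0 + 0 *\<^sub>R x)"
    by (intro DERIV_isconst_all[where f="\<lambda>s. primitive (act h 0 + s *\<^sub>R lin h x) - primitive (0 + s *\<^sub>R x)"]) blast
  then show ?thesis using act_affine[OF h, of 0 x] by simp
qed

lemma primitive_bounded:
  assumes "bounded S"
  obtains B where "\<And>x. x \<in> S \<Longrightarrow> \<bar>primitive x\<bar> \<le> B"
proof -
  obtain r where r: "\<And>x. x \<in> S \<Longrightarrow> norm x \<le> r" using assms unfolding bounded_iff by blast
  obtain B where B: "B \<ge> 0" "\<And>x v. x \<in> cball 0 r \<Longrightarrow> \<bar>\<theta> x v\<bar> \<le> B * norm v"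
    using form_upper_bound[OF compact_cball] by blast
  have "\<bar>primitive x\<bar> \<le> B * r * (1 - 0)" if "x \<in> S" for x
    unfolding primitive_def real_norm_def[symmetric]
  proof (rule integral_bound)
    show "continuous_on {0..1} (\<lambda>t. \<theta> (t *\<^sub>R x) x)"
      by (intro field_continuous_intros continuous_intros)
    fix t :: real assume t: "t \<in> {0..1}"
    have n: "norm x \<le> r" by (rule r[OF that])
    have "norm (t *\<^sub>R x) \<le> 1 * r" unfolding norm_scaleR using t n by (intro mult_mono) auto
    then have "\<bar>\<theta> (t *\<^sub>R x) x\<bar> \<le> B * norm x" by (intro B(2)) simp
    also have "\<dots> \<le> B * r" using n B(1) by (rule mult_left_mono)
    finally show "norm (\<theta> (t *\<^sub>R x) x) \<le> B * r" by simp
  qed simp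
  then show thesis by (rule that)
qed

text \<open>Along the straight Euler segment the derivative of the primitive starts at the constant
  of \<open>form_lee_constant\<close> and, for a uniformly short time, stays above half of it.
  Outside \<open>K\<close> both sides shift by the same period.\<close>

lemma euler_primitive_increase:
  obtains t0 \<kappa> where "t0 > 0" "\<kappa> > 0"
    "\<And>t x. 0 \<le> t \<Longrightarrow> t \<le> t0 \<Longrightarrow> primitive (euler t x) \<ge> primitive x + t * \<kappa>"
proof -
  obtain \<kappa> where \<kappa>: "\<kappa> > 0" "\<And>x. \<theta> x (lee x) = \<kappa>" using form_lee_constant by blast
  define q where "q = (\<lambda>(t, x). \<theta> (x + t *\<^sub>R lee x) (lee x))"
  have "continuous_on ({0..1} \<times> K) q"
    unfolding q_def split_beta
    by (intro field_continuous_intros continuous_intros continuous_on_compose2[OF lee_cont[of UNIV]]) auto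
  moreover have "q (0, x) = \<kappa>" for x by (simp add: q_def \<kappa>)
  ultimately obtain t0 where t0: "0 < t0" "t0 \<le> 1"
    and q: "\<And>t x. 0 \<le> t \<Longrightarrow> t \<le> t0 \<Longrightarrow> x \<in> K \<Longrightarrow> \<bar>q (t, x) - \<kappa>\<bar> \<le> \<kappa> / 2"
    using compact_uniform_limit_at_0[of K q \<kappa> "\<kappa> / 2"] compact_K \<kappa>(1) by (metis half_gt_zero)
  have inK: "primitive (euler t x) - primitive x \<ge> t * (\<kappa> / 2)" if t: "0 \<le> t" "t \<le> t0" and x: "x \<in> K" for t x
  proof (cases "t = 0")
    case False
    then have "t > 0" using t by simp
    from MVT2[OF this primitive_line_derivative[of x "lee x"]]
    obtain z where z: "0 < z" "z < t" and eq: "primitive (euler t x) - primitive x = t * q (z, x)"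
      unfolding q_def euler_def by auto
    have "\<bar>q (z, x) - \<kappa>\<bar> \<le> \<kappa> / 2" using z t x by (intro q) auto
    then have "\<kappa> / 2 \<le> q (z, x)" by linarith
    then show ?thesis unfolding eq using t(1) by (rule mult_left_mono)
  qed (simp add: euler_def)
  have "primitive (euler t x) \<ge> primitive x + t * (\<kappa> / 2)" if t: "0 \<le> t" "t \<le> t0" for t x
  proof -
    obtain h where h: "h \<in> H" "act h x \<in> K" using cocompact by blast
    show ?thesis
      using inK[OF t h(2)] primitive_act[OF h(1), of "euler t x"] primitive_act[OF h(1), of x]
      by (simp add: euler_equivariant[OF h(1)])
  qed
  then show thesis using that[of t0 "\<kappa> / 2"] t0 \<kappa> by auto
qed

text \<open>All four properties are carried through one induction because the last refers to the
  derivative \<open>D\<close> of the first, which the chain rule extends at every step.\<close>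

lemma euler_iterates:
  assumes "a \<ge> 0"
    and iso: "\<And>x v. g (euler t x) (deuler t x v) (deuler t x v) \<le> a * g x v v"
    and incr: "\<And>x. primitive (euler t x) \<ge> primitive x + b"
  shows "\<exists>D. \<forall>x. ((euler t ^^ n) has_derivative D x) (at x) \<and>
    (\<forall>h\<in>H. (euler t ^^ n) (act h x) = act h ((euler t ^^ n) x)) \<and>
    primitive ((euler t ^^ n) x) \<ge> primitive x + n * b \<and>
    (\<forall>v. g ((euler t ^^ n) x) (D x v) (D x v) \<le> a ^ n * g x v v)"
proof (induction n)
  case 0
  show ?case by (rule exI[of _ "\<lambda>x v. v"]) (auto simp: id_def)
next
  case (Suc n)
  then obtain D where D: "\<And>x. ((euler t ^^ n) has_derivative D x) (at x)"
    "\<And>x h. h \<in> H \<Longrightarrow> (euler t ^^ n) (act h x) = act h ((euler t ^^ n) x)"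
    "\<And>x. primitive ((euler t ^^ n) x) \<ge> primitive x + n * b"
    "\<And>x v. g ((euler t ^^ n) x) (D x v) (D x v) \<le> a ^ n * g x v v"
    by metis
  show ?case
  proof (intro exI[of _ "\<lambda>x v. deuler t ((euler t ^^ n) x) (D x v)"] allI conjI ballI)
    fix x v
    show "((euler t ^^ Suc n) has_derivative (\<lambda>v. deuler t ((euler t ^^ n) x) (D x v))) (at x)"
      using has_derivative_compose[OF D(1) euler_has_derivative] by (simp add: o_def)
    show "(euler t ^^ Suc n) (act h x) = act h ((euler t ^^ Suc n) x)" if "h \<in> H" for h
      using that by (simp add: D(2) euler_equivariant)
    show "primitive x + real (Suc n) * b \<le> primitive ((euler t ^^ Suc n) x)"
      using incr[of "(euler t ^^ n) x"] D(3)[of x] by (simp add: algebra_simps)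
    have "g (euler t ((euler t ^^ n) x)) (deuler t ((euler t ^^ n) x) (D x v)) (deuler t ((euler t ^^ n) x) (D x v))
       \<le> a * g ((euler t ^^ n) x) (D x v) (D x v)" by (rule iso)
    also have "\<dots> \<le> a * (a ^ n * g x v v)" using D(4) assms(1) by (rule mult_left_mono)
    finally show "g ((euler t ^^ Suc n) x) (deuler t ((euler t ^^ n) x) (D x v)) (deuler t ((euler t ^^ n) x) (D x v))
       \<le> a ^ Suc n * g x v v" by (simp add: mult.assoc)
  qed
qed

text \<open>A discrete substitute for the flow of the Lee field.\<close>

lemma equivariant_almost_isometry:
  assumes "T > 0"
  obtains \<psi> D where "\<And>x. (\<psi> has_derivative D x) (at x)"
    "\<And>h x. h \<in> H \<Longrightarrow> \<psi> (act h x) = act h (\<psi> x)"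
    "\<And>x. primitive (\<psi> x) \<ge> primitive x + T"
    "\<And>x v. g (\<psi> x) (D x v) (D x v) \<le> 3 * g x v v"
proof -
  obtain t1 \<kappa> where t1: "t1 > 0" "\<kappa> > 0"
    and incr: "\<And>t x. 0 \<le> t \<Longrightarrow> t \<le> t1 \<Longrightarrow> primitive (euler t x) \<ge> primitive x + t * \<kappa>"
    using euler_primitive_increase by blast
  \<comment> \<open>\<open>S\<close> is the total time that raises the primitive by \<open>T\<close>
    at rate \<open>\<kappa>\<close>. Allowing distortion at rate \<open>1 / S\<close> and splitting
    \<open>S\<close> into \<open>n\<close> equal steps gives the factor
    \<open>(1 + 1 / n) ^ n\<close>, whose bound does not depend on \<open>T\<close>.\<close>
  define S where "S = T / \<kappa>"
  have S: "S > 0" using assms t1 by (simp add: S_def)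
  then have S': "1 / S > 0" by simp
  obtain t2 where t2: "t2 > 0" and iso: "\<And>t x v. 0 \<le> t \<Longrightarrow> t \<le> t2 \<Longrightarrow>
     g (euler t x) (deuler t x v) (deuler t x v) \<le> (1 + (1 / S) * t) * g x v v"
    using euler_almost_isometry[OF S'] by blast
  obtain n :: nat where n: "n > S / min t1 t2" using reals_Archimedean2 by blast
  moreover have "S / min t1 t2 > 0" using S t1 t2 by simp
  ultimately have npos: "real n > 0" by linarith
  define t where "t = S / n"
  have "t < min t1 t2" using n npos t1 t2
    by (simp add: t_def pos_divide_less_eq mult.commute del: min_less_iff_conj)
  then have t: "0 \<le> t" "t \<le> t1" "t \<le> t2" using S npos by (auto simp: t_def)
  have "\<exists>D. \<forall>x. ((euler t ^^ n) has_derivative D x) (at x) \<and>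
    (\<forall>h\<in>H. (euler t ^^ n) (act h x) = act h ((euler t ^^ n) x)) \<and>
    primitive ((euler t ^^ n) x) \<ge> primitive x + n * (t * \<kappa>) \<and>
    (\<forall>v. g ((euler t ^^ n) x) (D x v) (D x v) \<le> (1 + (1 / S) * t) ^ n * g x v v)"
    by (rule euler_iterates) (use t S incr iso in auto)
  then obtain D where D: "\<And>x. ((euler t ^^ n) has_derivative D x) (at x)"
    "\<And>x h. h \<in> H \<Longrightarrow> (euler t ^^ n) (act h x) = act h ((euler t ^^ n) x)"
    "\<And>x. primitive ((euler t ^^ n) x) \<ge> primitive x + n * (t * \<kappa>)"
    "\<And>x v. g ((euler t ^^ n) x) (D x v) (D x v) \<le> (1 + (1 / S) * t) ^ n * g x v v"
    by metis
  have "n * (t * \<kappa>) = T" using npos t1 by (simp add: t_def S_def)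
  moreover have "(1 + (1 / S) * t) ^ n \<le> 3"
  proof -
    have "(1 + (1 / S) * t) ^ n \<le> exp (1 / n) ^ n"
      using S by (intro power_mono) (auto simp: t_def exp_ge_add_one_self)
    also have "\<dots> = exp 1" using npos by (simp flip: exp_of_nat_mult)
    also have "\<dots> \<le> 3" by (rule exp_le)
    finally show ?thesis .
  qed
  moreover have "g x v v \<ge> 0" for x v
    using g_pos[of v x] by (cases "v = 0") (auto simp: linear_simps)
  ultimately show thesis
    using that[of "euler t ^^ n" D] D by (metis mult_right_mono order_trans)
qed

end

section \<open>The lattice of an Oeljeklaus--Toma manifold\<close>

lemmas cart_eq_iff = Finite_Cartesian_Product.vec_eq_iff

lemma additive_subgroup_of_int_scale:
  fixes L :: "'a::real_vector set"
  assumes L: "0 \<in> L" "\<And>x y. x \<in> L \<Longrightarrow> y \<in> L \<Longrightarrow> x - y \<in> L" and "x \<in> L"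
  shows "of_int n *\<^sub>R x \<in> L"
proof -
  have neg: "- y \<in> L" if "y \<in> L" for y using L(2)[OF L(1) that] by simp
  have add: "y + z \<in> L" if "y \<in> L" "z \<in> L" for y z using L(2)[OF that(1) neg[OF that(2)]] by simp
  have nat: "real k *\<^sub>R x \<in> L" for k
    by (induction k) (auto simp: L(1) algebra_simps intro: add assms(3))
  show ?thesis
  proof (cases "n \<ge> 0")
    case True
    then show ?thesis using nat[of "nat n"] by simp
  next
    case False
    then show ?thesis using neg[OF nat[of "nat (- n)"]] by simp
  qed
qed

text \<open>Coordinates with respect to a basis contained in \<open>L\<close> are rounded down; the
  fractional parts leave a remainder bounded by the sum of the norms of the basis.\<close>

lemma additive_subgroup_cobounded:
  fixes L :: "'a::euclidean_space set"
  assumes L: "0 \<in> L" "\<And>x y. x \<in> L \<Longrightarrow> y \<in> L \<Longrightarrow> x - y \<in> L" and "span L = UNIV"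
  obtains R where "\<And>x. \<exists>l\<in>L. norm (l + x) \<le> R"
proof -
  obtain B where B: "B \<subseteq> L" "independent B" "L \<subseteq> span B"
    using maximal_independent_subset[of L] by blast
  have fin: "finite B" using B(2) by (rule independent_imp_finite)
  have "span B = UNIV" using span_minimal[OF B(3) subspace_span] assms(3) by auto
  have neg: "- y \<in> L" if "y \<in> L" for y using L(2)[OF L(1) that] by simp
  have add: "y + z \<in> L" if "y \<in> L" "z \<in> L" for y z using L(2)[OF that(1) neg[OF that(2)]] by simp
  have "\<exists>l\<in>L. norm (l + x) \<le> (\<Sum>b\<in>B. norm b)" for x
  proof -
    have "x \<in> range (\<lambda>r. \<Sum>b\<in>B. r b *\<^sub>R b)"
      using \<open>span B = UNIV\<close> by (simp add: span_finite[OF fin])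
    then obtain r where x: "x = (\<Sum>b\<in>B. r b *\<^sub>R b)" by blast
    define l where "l = (\<Sum>b\<in>B. of_int (- \<lfloor>r b\<rfloor>) *\<^sub>R b)"
    have sums: "sum f S \<in> L" if "finite S" "\<And>b. b \<in> S \<Longrightarrow> f b \<in> L" for S and f :: "'a \<Rightarrow> 'a"
      using that by (induction S rule: finite_induct) (auto intro: L(1) add)
    then have "l \<in> L"
      unfolding l_def using fin B(1) by (intro sums additive_subgroup_of_int_scale[OF L]) auto
    moreover have "l + x = (\<Sum>b\<in>B. frac (r b) *\<^sub>R b)"
      by (simp add: x l_def frac_def algebra_simps flip: sum.distrib)
    moreover have "norm (\<Sum>b\<in>B. frac (r b) *\<^sub>R b) \<le> (\<Sum>b\<in>B. norm b)"
    proof (rule sum_norm_le)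
      fix b assume "b \<in> B"
      have "\<bar>frac (r b)\<bar> * norm b \<le> 1 * norm b"
        by (rule mult_right_mono) (auto simp: frac_ge_0 abs_of_nonneg less_imp_le[OF frac_lt_1])
      then show "norm (frac (r b) *\<^sub>R b) \<le> norm b" by simp
    qed
    ultimately show ?thesis by (intro bexI[of _ l]) simp_all
  qed
  then show thesis by (rule that)
qed

section \<open>The group acting on itself by affine maps\<close>

definition OT_act :: "complex ^ 's ^ 't \<Rightarrow> (real ^ 's) \<times> (real ^ 's) \<times> (complex ^ 't) \<Rightarrow>
    (real ^ 's) \<times> (real ^ 's) \<times> (complex ^ 't) \<Rightarrow>
    (real ^ 's::finite) \<times> (real ^ 's) \<times> (complex ^ 't::finite)" where
  "OT_act C h x = (fst h + fst x, snd h + OT_phi C (fst h) (snd x))"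

definition OT_lin :: "complex ^ 's ^ 't \<Rightarrow> (real ^ 's) \<times> (real ^ 's) \<times> (complex ^ 't) \<Rightarrow>
    (real ^ 's) \<times> (real ^ 's) \<times> (complex ^ 't) \<Rightarrow>
    (real ^ 's::finite) \<times> (real ^ 's) \<times> (complex ^ 't::finite)" where
  "OT_lin C h v = (fst v, OT_phi C (fst h) (snd v))"

lemma OT_phi_linear: "linear (OT_phi C a)"
  by (rule linearI) (auto simp: OT_phi_def cart_eq_iff algebra_simps simp flip: scaleR_conv_of_real)

lemma OT_phi_0 [simp]: "OT_phi C 0 x = x"
  by (simp add: OT_phi_def)

lemma OT_phi_add: "OT_phi C (a + b) x = OT_phi C a (OT_phi C b x)"
  by (simp add: OT_phi_def cart_eq_iff exp_add algebra_simps sum.distrib)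

lemma OT_phi_inverse [simp]: "OT_phi C a (OT_phi C (- a) x) = x" "OT_phi C (- a) (OT_phi C a x) = x"
  by (simp_all flip: OT_phi_add)

lemma continuous_on_OT_phi:
  assumes "continuous_on S a" "continuous_on S x"
  shows "continuous_on S (\<lambda>s. OT_phi C (a s) (x s))"
  unfolding OT_phi_def by (intro continuous_intros assms)

lemma OT_phi_bounded_on_compact:
  assumes "compact A"
  obtains E where "\<And>a x. a \<in> A \<Longrightarrow> norm (OT_phi C a x) \<le> E * norm x"
proof -
  have "continuous_on (A \<times> sphere 0 1) (\<lambda>p. OT_phi C (fst p) (snd p))"
    by (intro continuous_on_OT_phi continuous_intros)
  then have "bounded ((\<lambda>p. OT_phi C (fst p) (snd p)) ` (A \<times> sphere 0 1))"
    using assms by (intro compact_imp_bounded compact_continuous_image compact_Times compact_sphere)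
  then obtain E where E: "\<And>p. p \<in> A \<times> sphere 0 1 \<Longrightarrow> norm (OT_phi C (fst p) (snd p)) \<le> E"
    unfolding bounded_iff by blast
  have "norm (OT_phi C a x) \<le> E * norm x" if "a \<in> A" for a x
  proof (cases "x = 0")
    case False
    have "norm (OT_phi C a (x /\<^sub>R norm x)) \<le> E"
      using E[of "(a, x /\<^sub>R norm x)"] that False by simp
    then show ?thesis using False by (simp add: linear_scale[OF OT_phi_linear] field_simps)
  qed (simp add: linear_0[OF OT_phi_linear])
  then show thesis by (rule that)
qed

lemma OT_act_assoc: "OT_act C (OT_act C h k) x = OT_act C h (OT_act C k x)"
  by (simp add: OT_act_def OT_phi_add linear_add[OF OT_phi_linear] add.assoc)

lemma OT_act_affine: "OT_act C h (x + v) = OT_act C h x + OT_lin C h v"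
  by (simp add: OT_act_def OT_lin_def linear_add[OF OT_phi_linear] add.assoc)

lemma OT_lin_linear: "linear (OT_lin C h)"
  by (rule linearI)
    (auto simp: OT_lin_def linear_add[OF OT_phi_linear] linear_scale[OF OT_phi_linear])

lemma OT_lin_surj: "surj (OT_lin C h)"
  by (rule surjI[of _ "\<lambda>v. (fst v, OT_phi C (- fst h) (snd v))"]) (simp add: OT_lin_def)

section \<open>Units, integers and the lattice they generate\<close>

locale OT_data =
  fixes \<sigma> :: "'s::finite \<Rightarrow> 'k::field_char_0 \<Rightarrow> real" and \<tau> :: "'t::finite \<Rightarrow> 'k \<Rightarrow> complex"
    and U :: "'k set" and C :: "complex ^ 's ^ 't"
  assumes number_field: "number_field TYPE('k)"
    and embeddings: "lists_embeddings \<sigma> \<tau>"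
    and U_subgroup: "subgroup U (positive_units \<sigma>)"
    and U_lattice: "lattice_in_space (log_embedding \<sigma> ` U)"
    and C: "\<forall>u\<in>U. \<forall>i. \<tau> i u = exp (\<Sum>j\<in>UNIV. C $ i $ j * of_real (ln (\<sigma> j u)))"
begin

text \<open>The Minkowski embedding, taken on the whole field because the spanning argument passes
  from integers to arbitrary elements.\<close>

definition emb :: "'k \<Rightarrow> (real ^ 's) \<times> (complex ^ 't)" where
  "emb x = (\<chi> j. \<sigma> j x, \<chi> i. \<tau> i x)"

abbreviation (input) "H \<equiv> OT_lattice \<sigma> \<tau> U"

lemma H_eq: "H = log_embedding \<sigma> ` U \<times> emb ` {x. algebraic_int x}"
  by (simp add: OT_lattice_def emb_def ring_of_integers_def)

lemma field_embedding_\<sigma>: "field_embedding (\<sigma> j)"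
  using embeddings bij_betwE[of \<sigma>] unfolding lists_embeddings_def by blast

lemma field_embedding_\<tau>: "field_embedding (\<tau> i)"
  using embeddings unfolding lists_embeddings_def by blast

lemmas emb_simps = field_embedding_simps[OF field_embedding_\<sigma>] field_embedding_simps[OF field_embedding_\<tau>]

lemma emb_add: "emb (x + y) = emb x + emb y" and emb_diff: "emb (x - y) = emb x - emb y"
  and emb_minus: "emb (- x) = - emb x" and emb_0: "emb 0 = 0"
  by (simp_all add: emb_def emb_simps cart_eq_iff zero_prod_def)

lemma emb_eq_0_iff: "emb x = 0 \<longleftrightarrow> x = 0"
  using field_embedding_eq_0_iff[OF field_embedding_\<tau>]
  by (auto simp: emb_def zero_prod_def cart_eq_iff emb_simps)

lemma inj_emb: "inj emb"
  using emb_eq_0_iff[of "_ - _"] by (intro injI) (simp add: emb_diff)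

lemma U_D:
  assumes "u \<in> U"
  shows "u \<noteq> 0" "algebraic_int u" "\<sigma> j u > 0"
  using subgroup.subset[OF U_subgroup] assms by (auto simp: positive_units_def ring_of_integers_def)

lemma U_1: "1 \<in> U"
  using subgroup.one_closed[OF U_subgroup] by (simp add: positive_units_def)

lemma U_mult: "u \<in> U \<Longrightarrow> v \<in> U \<Longrightarrow> u * v \<in> U"
  using subgroup.m_closed[OF U_subgroup] by (simp add: positive_units_def)

lemma log_embedding_mult: "u \<in> U \<Longrightarrow> v \<in> U \<Longrightarrow> log_embedding \<sigma> (u * v) = log_embedding \<sigma> u + log_embedding \<sigma> v"
  by (simp add: log_embedding_def cart_eq_iff emb_simps ln_mult_pos U_D)

lemma log_embedding_1: "log_embedding \<sigma> 1 = 0"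
  by (simp add: log_embedding_def cart_eq_iff emb_simps)

text \<open>A single real embedding suffices, being injective as a homomorphism of fields.\<close>

lemma log_embedding_eq_0_iff: "u \<in> U \<Longrightarrow> log_embedding \<sigma> u = 0 \<longleftrightarrow> u = 1"
proof
  fix j :: 's
  assume u: "u \<in> U" "log_embedding \<sigma> u = 0"
  then have "\<sigma> j u = \<sigma> j 1" using U_D(3)[OF u(1)] by (simp add: log_embedding_def cart_eq_iff emb_simps)
  then show "u = 1" using field_embedding_inj[OF field_embedding_\<sigma>] by (blast dest: injD)
qed (simp add: log_embedding_1)

text \<open>The inverse is found in the lattice of logarithms: some \<open>v\<close> has the
  logarithm opposite to that of \<open>u\<close>, and then \<open>v * u\<close> has logarithm
  0.\<close>

lemma U_inverse:
  assumes u: "u \<in> U"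
  shows "inverse u \<in> U"
proof -
  have "0 - log_embedding \<sigma> u \<in> log_embedding \<sigma> ` U"
    using U_lattice u unfolding lattice_in_space_def by blast
  then obtain v where v: "v \<in> U" "log_embedding \<sigma> v = - log_embedding \<sigma> u" by auto
  then have "log_embedding \<sigma> (v * u) = 0" using u by (simp add: log_embedding_mult)
  then have "v * u = 1" using log_embedding_eq_0_iff U_mult u v by blast
  then have "inverse u = v" by (metis inverse_unique mult.commute)
  then show ?thesis using v by simp
qed

lemma log_embedding_inverse: "u \<in> U \<Longrightarrow> log_embedding \<sigma> (inverse u) = - log_embedding \<sigma> u"
  using log_embedding_mult[of u "inverse u"] U_D(1)[of u]
  by (simp add: U_inverse log_embedding_1 eq_neg_iff_add_eq_0 add.commute)

text \<open>This is what the matrix \<open>C\<close> is chosen for. It makes the pairs of units and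
  integers a group and turns conjugation by \<open>u\<close> into multiplication by
  \<open>u\<close>.\<close>

lemma OT_phi_emb:
  assumes "u \<in> U"
  shows "OT_phi C (log_embedding \<sigma> u) (emb x) = emb (u * x)"
  using C assms U_D(3)[OF assms]
  by (simp add: OT_phi_def emb_def log_embedding_def cart_eq_iff emb_simps)

lemma H_closed:
  assumes "h \<in> H" "k \<in> H"
  shows "OT_act C h k \<in> H"
proof -
  obtain u x where h: "h = (log_embedding \<sigma> u, emb x)" "u \<in> U" "algebraic_int x"
    using assms(1) unfolding H_eq by auto
  obtain v y where k: "k = (log_embedding \<sigma> v, emb y)" "v \<in> U" "algebraic_int y"
    using assms(2) unfolding H_eq by auto
  have "OT_act C h k = (log_embedding \<sigma> (u * v), emb (x + u * y))"
    by (simp add: OT_act_def h k log_embedding_mult OT_phi_emb emb_add)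
  then show ?thesis unfolding H_eq
    using h k by (auto intro!: imageI U_mult algebraic_int_add algebraic_int_mult U_D(2)[OF h(2)])
qed

lemma H_inverse:
  assumes "h \<in> H"
  obtains k where "k \<in> H" "OT_act C k h = 0"
proof -
  obtain u x where h: "h = (log_embedding \<sigma> u, emb x)" "u \<in> U" "algebraic_int x"
    using assms(1) unfolding H_eq by auto
  let ?k = "(log_embedding \<sigma> (inverse u), emb (0 - inverse u * x))"
  have "?k \<in> H"
    unfolding H_eq using h
    by (intro SigmaI imageI CollectI algebraic_int_diff algebraic_int_mult U_inverse
        U_D(2)[OF U_inverse[OF h(2)]]) auto
  moreover have "OT_act C ?k h = 0"
  proof -
    have "OT_phi C (log_embedding \<sigma> (inverse u)) (emb x) = emb (inverse u * x)"
      by (rule OT_phi_emb[OF U_inverse[OF h(2)]])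
    then show ?thesis
      by (simp add: OT_act_def h(1)) (simp add: log_embedding_inverse[OF h(2)] emb_minus zero_prod_def)
  qed
  ultimately show thesis by (rule that)
qed

text \<open>A vector \<open>a\<close> orthogonal to all integers is orthogonal to the image of the
  whole field, by clearing denominators. Rewritten over the complex numbers, this is a linear
  relation between all the embeddings, which must be trivial.\<close>

lemma emb_span: "span (emb ` {x. algebraic_int x}) = UNIV"
proof (rule ccontr)
  assume "span (emb ` {x. algebraic_int x}) \<noteq> UNIV"
  then obtain a where a: "a \<noteq> 0" "\<And>y. y \<in> span (emb ` {x. algebraic_int x}) \<Longrightarrow> a \<bullet> y = 0"
    using span_not_UNIV_orthogonal by blast
  have orth: "a \<bullet> emb x = 0" for x
  proof -
    obtain n :: nat where n: "n > 0" "algebraic_int (of_nat n * x)"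
      using algebraic_multiple_algebraic_int[OF number_field_algebraic[OF number_field]] by blast
    have "emb (of_nat n * x) = real n *\<^sub>R emb x"
      by (simp add: emb_def emb_simps field_embedding_of_nat[OF field_embedding_\<sigma>]
          field_embedding_of_nat[OF field_embedding_\<tau>] cart_eq_iff
          scaleR_conv_of_real[where 'a = complex])
    moreover have "a \<bullet> emb (of_nat n * x) = 0" using n by (intro a(2) span_base) auto
    ultimately show ?thesis using n by simp
  qed
  \<comment> \<open>Three kinds of index: real embeddings, chosen non-real ones, and their
    conjugates.\<close>
  define e :: "'s + 't + 't \<Rightarrow> 'k \<Rightarrow> complex" where
    "e = case_sum (\<lambda>j. of_real \<circ> \<sigma> j) (case_sum \<tau> (\<lambda>i. cnj \<circ> \<tau> i))"
  \<comment> \<open>The coefficients come from doubling the inner product, because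
    \<open>2 * (z \<bullet> w)\<close> is \<open>cnj z * w + z * cnj w\<close>; hence the factor 2
    at the real embeddings.\<close>
  define c :: "'s + 't + 't \<Rightarrow> complex" where
    "c = case_sum (\<lambda>j. of_real (2 * fst a $ j)) (case_sum (\<lambda>i. cnj (snd a $ i)) (\<lambda>i. snd a $ i))"
  have cases: P if "\<And>j. i = Inl j \<Longrightarrow> P" "\<And>k. i = Inr (Inl k) \<Longrightarrow> P" "\<And>k. i = Inr (Inr k) \<Longrightarrow> P"
    for P and i :: "'s + 't + 't"
    using that by (metis sum.exhaust)
  have "field_embedding (e i)" for i
    using field_embedding_\<sigma> field_embedding_\<tau>
    by - (rule cases[of i], auto simp: e_def field_embedding_def)
  moreover have "inj e"
  proof -
    have s: "inj \<sigma>" and t: "inj \<tau>"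
      and d: "\<And>i i'. \<tau> i \<noteq> cnj \<circ> \<tau> i'" and nr: "\<And>i. \<not> range (\<tau> i) \<subseteq> \<real>" "\<And>i. \<not> range (cnj \<circ> \<tau> i) \<subseteq> \<real>"
      using embeddings unfolding lists_embeddings_def bij_betw_def by blast+
    have r: "range (complex_of_real \<circ> \<sigma> j) \<subseteq> \<real>" for j by auto
    have ss: "(complex_of_real \<circ> \<sigma> j = complex_of_real \<circ> \<sigma> j') \<longleftrightarrow> j = j'" for j j'
      using s by (auto simp: fun_eq_iff inj_def)
    have cc: "(cnj \<circ> \<tau> i = cnj \<circ> \<tau> i') \<longleftrightarrow> i = i'" for i i'
      using t by (auto simp: fun_eq_iff inj_def)
    have tt: "\<tau> i = \<tau> i' \<longleftrightarrow> i = i'" for i i' using t by (auto simp: inj_def)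
    have rs: "complex_of_real \<circ> \<sigma> j \<noteq> \<tau> i" "complex_of_real \<circ> \<sigma> j \<noteq> cnj \<circ> \<tau> i" for i j
      using nr[of i] r[of j] by metis+
    show ?thesis
    proof (rule injI)
      fix x y assume "e x = e y"
      then show "x = y"
        by - (rule cases[of x]; rule cases[of y];
            simp add: e_def ss cc tt d rs d[symmetric] rs[symmetric])
    qed
  qed
  moreover have "(\<Sum>i\<in>UNIV. c i * e i x) = 0" for x
  proof -
    have cpx: "cnj z * w + z * cnj w = of_real (2 * (z \<bullet> w))" for z w
      by (simp add: complex_eq_iff inner_complex_def)
    have "(\<Sum>i\<in>UNIV. c i * e i x) = (\<Sum>j\<in>UNIV. of_real (2 * fst a $ j * \<sigma> j x))
        + ((\<Sum>i\<in>UNIV. cnj (snd a $ i) * \<tau> i x) + (\<Sum>i\<in>UNIV. snd a $ i * cnj (\<tau> i x)))"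
      by (simp add: UNIV_Plus_UNIV[symmetric] sum.Plus c_def e_def del: UNIV_Plus_UNIV)
    also have "\<dots> = of_real (2 * (a \<bullet> emb x))"
      unfolding sum.distrib[symmetric] cpx
      by (simp add: inner_prod_def inner_vec_def emb_def sum_distrib_left algebra_simps)
    finally show ?thesis by (simp add: orth)
  qed
  ultimately have "c i = 0" for i
    using embeddings_independent[of UNIV e c i] by simp
  from this[of "Inl _"] this[of "Inr (Inr _)"] have "a = 0"
    by (simp add: c_def prod_eq_iff cart_eq_iff)
  then show False using a(1) by simp
qed

lemma H_cocompact:
  obtains K where "compact K" "\<And>x. \<exists>h\<in>H. OT_act C h x \<in> K"
proof -
  obtain R1 where R1: "\<And>a. \<exists>l\<in>log_embedding \<sigma> ` U. norm (l + a) \<le> R1"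
    using U_lattice additive_subgroup_cobounded[of "log_embedding \<sigma> ` U"]
    unfolding lattice_in_space_def by metis
  obtain R2 where R2: "\<And>y. \<exists>l\<in>emb ` {x. algebraic_int x}. norm (l + y) \<le> R2"
  proof (rule additive_subgroup_cobounded[OF _ _ emb_span])
    show "0 \<in> emb ` {x. algebraic_int x}" using emb_0 by (metis algebraic_int_0 image_eqI mem_Collect_eq)
    show "x - y \<in> emb ` {x. algebraic_int x}"
      if "x \<in> emb ` {x. algebraic_int x}" "y \<in> emb ` {x. algebraic_int x}" for x y
      using that algebraic_int_diff by (auto simp flip: emb_diff intro!: imageI)
  qed blast
  have "\<exists>h\<in>H. OT_act C h x \<in> cball 0 R1 \<times> cball 0 R2" for x
  proof -
    obtain l1 where l1: "l1 \<in> log_embedding \<sigma> ` U" "norm (l1 + fst x) \<le> R1" using R1 by blast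
    \<comment> \<open>The unit part \<open>l1\<close> acts on the second factor before the
      translation, so \<open>l2\<close> is adapted to the point already scaled.\<close>
    obtain l2 where l2: "l2 \<in> emb ` {x. algebraic_int x}" "norm (l2 + OT_phi C l1 (snd x)) \<le> R2" using R2 by blast
    show ?thesis using l1 l2 by (intro bexI[of _ "(l1, l2)"]) (auto simp: OT_act_def H_eq)
  qed
  then show thesis using that[of "cball 0 R1 \<times> cball 0 R2"] by (simp add: compact_Times)
qed

text \<open>The difference of two units is an algebraic integer, so \<open>disc\<close> keeps
  distinct units at distance at least \<open>e\<close>. A bounded uniformly discrete set is
  finite.\<close>

lemma finite_units_bounded_emb:
  assumes "e > 0" and disc: "\<And>x. algebraic_int x \<Longrightarrow> norm (emb x) < e \<Longrightarrow> x = 0"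
  shows "finite {u \<in> U. norm (emb u) \<le> B}"
proof -
  let ?S = "emb ` {u \<in> U. norm (emb u) \<le> B}"
  have "uniform_discrete ?S"
    unfolding uniform_discrete_def
  proof (intro exI[of _ e] conjI ballI impI)
    fix x y assume "x \<in> ?S" "y \<in> ?S" and lt: "dist x y < e"
    then obtain u v where uv: "x = emb u" "y = emb v" "u \<in> U" "v \<in> U" by blast
    have "algebraic_int (u - v)" using uv U_D(2) algebraic_int_diff by blast
    moreover have "norm (emb (u - v)) < e" using lt by (simp add: uv emb_diff dist_norm)
    ultimately have "u - v = 0" by (rule disc)
    then show "x = y" by (simp add: uv)
  qed (rule assms(1))
  moreover have "bounded ?S" unfolding bounded_iff by auto
  ultimately have "finite ?S" using uniform_discrete_finite_iff by blast
  then show ?thesis using inj_emb by (meson finite_imageD inj_on_subset subset_UNIV)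
qed

text \<open>Some unit differs from 1, since the logarithms of \<open>U\<close> span a nonzero space;
  a denominator of \<open>x / (u - 1)\<close> then serves as \<open>n\<close>.\<close>

lemma unit_minus_1_divides:
  assumes "algebraic_int x"
  obtains u w n where "u \<in> U" "algebraic_int w" "n > 0" "(u - 1) * w = of_nat n * x"
proof -
  have "\<exists>u\<in>U. u \<noteq> 1"
  proof (rule ccontr)
    assume "\<not> (\<exists>u\<in>U. u \<noteq> 1)"
    then have "log_embedding \<sigma> ` U \<subseteq> {0}" using log_embedding_1 by auto
    then have "span (log_embedding \<sigma> ` U) \<subseteq> {0}" by (rule span_minimal) (rule subspace_single_0)
    then have "(UNIV :: (real ^ 's) set) \<subseteq> {0}" using U_lattice by (simp add: lattice_in_space_def)
    then have "(1 :: real ^ 's) = 0" by blast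
    then show False by simp
  qed
  then obtain u where u: "u \<in> U" "u \<noteq> 1" by blast
  obtain n :: nat where n: "n > 0" "algebraic_int (of_nat n * (x / (u - 1)))"
    using algebraic_multiple_algebraic_int[OF number_field_algebraic[OF number_field]] by blast
  have "(u - 1) * (of_nat n * (x / (u - 1))) = of_nat n * x" using u by simp
  then show thesis using that u n by blast
qed

text \<open>A homomorphism from \<open>\<Gamma>\<close> to the reals kills the ring of integers, because conjugation by \<open>u\<close>
  multiplies an integer by \<open>u\<close>, and \<open>u - 1\<close> divides a multiple of every integer.\<close>

lemma lattice_hom_vanishes_on_integers:
  fixes f :: "(real ^ 's) \<times> (real ^ 's) \<times> (complex ^ 't) \<Rightarrow> real"
  assumes hom: "\<And>h k. h \<in> H \<Longrightarrow> k \<in> H \<Longrightarrow> f (OT_act C h k) = f h + f k"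
    and u: "u \<in> U" and x: "algebraic_int x"
  shows "f (log_embedding \<sigma> u, emb x) = f (log_embedding \<sigma> u, 0)"
proof -
  define T where "T x = f (0, emb x)" for x
  have mem: "(log_embedding \<sigma> v, emb y) \<in> H" if "v \<in> U" "algebraic_int y" for v y
    using that by (simp add: H_eq)
  have mem1: "(0, emb y) \<in> H" if "algebraic_int y" for y
    using mem[OF U_1 that] by (simp add: log_embedding_1)
  have mem0: "(log_embedding \<sigma> v, 0) \<in> H" if "v \<in> U" for v
    using mem[OF that, of 0] by (simp add: emb_0)
  have add: "T (y + z) = T y + T z" if "algebraic_int y" "algebraic_int z" for y z
    using hom[OF mem1[OF that(1)] mem1[OF that(2)]] by (simp add: T_def OT_act_def emb_add)
  have T0: "T 0 = 0" using add[of 0 0] by simp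
  have mult: "algebraic_int (of_nat n * y) \<and> T (of_nat n * y) = n * T y" if "algebraic_int y" for n y
    by (induction n) (auto simp: T0 add that algebraic_int_add distrib_right algebra_simps)
  have unit: "T (v * y) = T y" if "v \<in> U" "algebraic_int y" for v y
  proof -
    \<comment> \<open>The conjugation relation without inverses: both products are the pair of
      \<open>v\<close> and \<open>v * y\<close>.\<close>
    have "f (OT_act C (0, emb (v * y)) (log_embedding \<sigma> v, 0)) = f (OT_act C (log_embedding \<sigma> v, 0) (0, emb y))"
      using that by (simp add: OT_act_def OT_phi_emb)
    moreover have "algebraic_int (v * y)" using that by (intro algebraic_int_mult U_D(2)[OF that(1)])
    ultimately show ?thesis using that by (simp add: hom mem0 mem1 T_def)
  qed
  obtain v w n where v: "v \<in> U" "algebraic_int w" "n > 0" "(v - 1) * w = of_nat n * x"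
    using unit_minus_1_divides[OF x] by blast
  have "n * T x = T ((v - 1) * w)" using mult[OF x, of n] v(4) by simp
  also have "\<dots> = T (v * w) - T w"
    using add[of "(v - 1) * w" w] mult[OF x, of n] v by (simp add: algebra_simps)
  finally have "T x = 0" using v(3) by (simp add: unit v)
  have "f (log_embedding \<sigma> u, emb x) = f (OT_act C (0, emb x) (log_embedding \<sigma> u, 0))"
    by (simp add: OT_act_def)
  also have "\<dots> = T x + f (log_embedding \<sigma> u, 0)" unfolding T_def by (rule hom[OF mem1[OF x] mem0[OF u]])
  finally show ?thesis using \<open>T x = 0\<close> by simp
qed

end

section \<open>Nonexistence of equivariant parallel one-forms\<close>

lemma curve_displacement_bound:
  fixes d :: "real \<Rightarrow> 'a::real_normed_vector"
  assumes "\<And>s. 0 \<le> s \<Longrightarrow> s \<le> 1 \<Longrightarrow> (d has_vector_derivative d' s) (at s)"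
    and "\<And>s. 0 \<le> s \<Longrightarrow> s \<le> 1 \<Longrightarrow> norm (d' s) \<le> B" and "0 \<le> s" "s \<le> 1"
  shows "norm (d s - d 0) \<le> B"
proof -
  have "B \<ge> 0" using assms(2)[of 0] by (metis norm_ge_zero order_refl order_trans zero_le_one)
  have "norm (d s - d 0) \<le> B * norm (s - 0)"
  proof (rule differentiable_bound)
    fix r :: real assume r: "r \<in> {0..1}"
    then show "(d has_derivative (\<lambda>t. t *\<^sub>R d' r)) (at r within {0..1})"
      using assms(1)[of r] has_vector_derivative_at_within unfolding has_vector_derivative_def by fastforce
    show "onorm (\<lambda>t. t *\<^sub>R d' r) \<le> B"
    proof (rule onorm_le)
      fix t :: real
      show "norm (t *\<^sub>R d' r) \<le> B * norm t"
        using mult_right_mono[OF assms(2)[of r], of "norm t"] r by (simp add: mult.commute)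
    qed
  qed (use assms in auto)
  also have "\<dots> \<le> B * 1" using \<open>B \<ge> 0\<close> assms by (intro mult_left_mono) auto
  finally show ?thesis by simp
qed

text \<open>The left-invariant norm that is Euclidean at the identity: the tangent vector
  \<open>v\<close> is transported from \<open>x\<close> back to the identity. It links
  \<open>g\<close> to the coordinates uniformly on the whole group.\<close>

definition left_invariant_norm :: "complex ^ 's ^ 't \<Rightarrow> (real ^ 's) \<times> (real ^ 's) \<times> (complex ^ 't) \<Rightarrow>
    (real ^ 's::finite) \<times> (real ^ 's) \<times> (complex ^ 't::finite) \<Rightarrow> real" where
  "left_invariant_norm C x v = norm (fst v, OT_phi C (- fst x) (snd v))"

lemma left_invariant_norm_OT_act:
  "left_invariant_norm C (OT_act C h x) (OT_lin C h v) = left_invariant_norm C x v"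
  by (simp add: left_invariant_norm_def OT_act_def OT_lin_def flip: OT_phi_add)

lemma left_invariant_norm_bounded_on_compact:
  assumes "compact K"
  obtains E where "\<And>x v. x \<in> K \<Longrightarrow> left_invariant_norm C x v \<le> E * norm v"
proof -
  have "compact ((\<lambda>x. - fst x) ` K)"
    using assms by (intro compact_continuous_image continuous_intros)
  then obtain E where E: "\<And>a y. a \<in> (\<lambda>x. - fst x) ` K \<Longrightarrow> norm (OT_phi C a y) \<le> E * norm y"
    using OT_phi_bounded_on_compact by blast
  have "left_invariant_norm C x v \<le> (1 + \<bar>E\<bar>) * norm v" if "x \<in> K" for x v
  proof -
    have "norm (OT_phi C (- fst x) (snd v)) \<le> E * norm (snd v)" using that by (intro E) auto
    also have "\<dots> \<le> \<bar>E\<bar> * norm v"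
      using norm_snd_le[of "snd v" "fst v"] by (intro mult_mono) auto
    finally show ?thesis
      using norm_Pair_le[of "fst v" "OT_phi C (- fst x) (snd v)"] norm_fst_le[of "fst v" "snd v"]
      by (simp add: left_invariant_norm_def algebra_simps)
  qed
  then show thesis by (rule that)
qed

context OT_data begin

lemma no_equivariant_parallel_form:
  assumes data: "parallel_one_form_data g \<Gamma> \<theta> H (OT_act C) (OT_lin C) K"
    and "e > 0" and disc: "\<And>x. algebraic_int x \<Longrightarrow> norm (emb x) < e \<Longrightarrow> x = 0"
  shows False
proof -
  interpret parallel_one_form_data g \<Gamma> \<theta> H "OT_act C" "OT_lin C" K by (rule data)
  \<comment> \<open>\<open>w\<close> plays two roles: the lattice element of the integer 1, and the
    end point of the segment from 0 to its translate.\<close>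
  define w where "w = (0 :: real ^ 's, emb 1)"
  have wH: "w \<in> H" using U_1 by (auto simp: w_def H_eq log_embedding_1[symmetric])
  obtain c where c: "c > 0" "\<And>x v. x \<in> K \<Longrightarrow> c * (norm v)\<^sup>2 \<le> g x v v"
    using g_lower_bound[OF compact_K] by blast
  obtain E where E: "\<And>x v. x \<in> K \<Longrightarrow> left_invariant_norm C x v \<le> E * norm v"
    using left_invariant_norm_bounded_on_compact[OF compact_K] by blast
  \<comment> \<open>Over \<open>K\<close> this compares two norms on a compact set; both sides are
    invariant, so it holds at every point.\<close>
  have left: "(left_invariant_norm C x v)\<^sup>2 \<le> E\<^sup>2 / c * g x v v" for x v
  proof -
    have inK: "(left_invariant_norm C x v)\<^sup>2 \<le> E\<^sup>2 / c * g x v v" if "x \<in> K" for x v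
    proof -
      have "(left_invariant_norm C x v)\<^sup>2 \<le> (E * norm v)\<^sup>2"
        using E[OF that] by (intro power_mono) (simp_all add: left_invariant_norm_def)
      also have "\<dots> = E\<^sup>2 / c * (c * (norm v)\<^sup>2)" using c(1) by (simp add: power_mult_distrib)
      also have "\<dots> \<le> E\<^sup>2 / c * g x v v" using c that by (intro mult_left_mono) auto
      finally show ?thesis .
    qed
    obtain h where h: "h \<in> H" "OT_act C h x \<in> K" using cocompact by blast
    from inK[OF h(2), of "OT_lin C h v"] show ?thesis
      by (simp add: left_invariant_norm_OT_act g_invariant[OF h(1)])
  qed
  have "bounded ((\<lambda>s. g (s *\<^sub>R w) w w) ` {0..1::real})"
    by (intro compact_imp_bounded compact_continuous_image field_continuous_intros continuous_intros) simp
  then obtain M where "\<forall>y\<in>(\<lambda>s. g (s *\<^sub>R w) w w) ` {0..1}. norm y \<le> M"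
    unfolding bounded_iff by blast
  then have M: "g (s *\<^sub>R w) w w \<le> M" if "0 \<le> s" "s \<le> 1" for s
    using that by (auto simp: abs_le_iff)
  \<comment> \<open>A speed bound for the image of the segment under every map \<open>\<psi>\<close>
    used below; the 3 is the distortion of \<open>equivariant_almost_isometry\<close>.\<close>
  define Q where "Q = sqrt (E\<^sup>2 / c * (3 * M))"
  obtain R where R: "\<And>x. x \<in> K \<Longrightarrow> norm x \<le> R"
    using compact_imp_bounded[OF compact_K] unfolding bounded_iff by blast
  obtain P where P: "\<And>a y. a \<in> cball 0 (R + Q) \<Longrightarrow> norm (OT_phi C a y) \<le> P * norm y"
    using OT_phi_bounded_on_compact[OF compact_cball] by blast
  obtain F where F: "\<And>x. x \<in> K \<Longrightarrow> \<bar>primitive x\<bar> \<le> F"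
    using primitive_bounded[OF compact_imp_bounded[OF compact_K]] by blast
  \<comment> \<open>The period homomorphism from the lattice to the reals.\<close>
  define f where "f h = primitive (OT_act C h 0) - primitive 0" for h
  have prim: "primitive (OT_act C h x) = primitive x + f h" if "h \<in> H" for h x
    using primitive_act[OF that, of x] by (simp add: f_def)
  have hom: "f (OT_act C h k) = f h + f k" if "h \<in> H" "k \<in> H" for h k
    using prim[OF that(1), of "OT_act C k 0"] unfolding f_def OT_act_assoc by linarith
  define S where "S = {u \<in> U. norm (emb u) \<le> \<bar>P\<bar> * Q}"
  have "finite S" unfolding S_def using finite_units_bounded_emb[OF assms(2) disc] by blast
  then have "bounded ((\<lambda>u. f (log_embedding \<sigma> u, 0)) ` S)" by (intro finite_imp_bounded finite_imageI)
  then obtain B where B: "\<And>u. u \<in> S \<Longrightarrow> \<bar>f (log_embedding \<sigma> u, 0)\<bar> \<le> B"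
    unfolding bounded_iff by auto
  \<comment> \<open>Large enough to contradict the bounds on the primitive over \<open>K\<close> and
    on the periods over \<open>S\<close>, all of which are fixed by now.\<close>
  define T where "T = \<bar>F\<bar> + \<bar>B\<bar> + \<bar>primitive 0\<bar> + 1"
  have "T > 0" by (simp add: T_def add_nonneg_pos)
  then obtain \<psi> D where \<psi>: "\<And>x. (\<psi> has_derivative D x) (at x)"
    "\<And>h x. h \<in> H \<Longrightarrow> \<psi> (OT_act C h x) = OT_act C h (\<psi> x)"
    "\<And>x. primitive (\<psi> x) \<ge> primitive x + T"
    "\<And>x v. g (\<psi> x) (D x v) (D x v) \<le> 3 * g x v v"
    using equivariant_almost_isometry by metis
  obtain h where h: "h \<in> H" "OT_act C h (\<psi> 0) \<in> K" using cocompact by blast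
  obtain u o' where uo: "h = (log_embedding \<sigma> u, emb o')" "u \<in> U" "algebraic_int o'"
    using h(1) unfolding H_eq by auto
  define d where "d s = OT_act C h (\<psi> (s *\<^sub>R w))" for s :: real
  define d' where "d' s = OT_lin C h (D (s *\<^sub>R w) w)" for s :: real
  have deriv: "(d has_vector_derivative d' s) (at s)" for s
  proof -
    have "((\<lambda>s. s *\<^sub>R w) has_derivative (\<lambda>t. t *\<^sub>R w)) (at s)" by (auto intro!: derivative_eq_intros)
    from has_derivative_compose[OF has_derivative_compose[OF this \<psi>(1)] act_has_derivative[OF h(1)]]
    have "(d has_derivative (\<lambda>t. OT_lin C h (D (s *\<^sub>R w) (t *\<^sub>R w)))) (at s)" unfolding d_def .
    then show ?thesis
      unfolding has_vector_derivative_def d'_def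
      using linear_scale[OF has_derivative_linear[OF \<psi>(1)]] by (simp add: linear_scale[OF OT_lin_linear])
  qed
  have speed: "left_invariant_norm C (d s) (d' s) \<le> Q" if "0 \<le> s" "s \<le> 1" for s
  proof -
    have "(left_invariant_norm C (d s) (d' s))\<^sup>2 = (left_invariant_norm C (\<psi> (s *\<^sub>R w)) (D (s *\<^sub>R w) w))\<^sup>2"
      by (simp add: d_def d'_def left_invariant_norm_OT_act)
    also have "\<dots> \<le> E\<^sup>2 / c * g (\<psi> (s *\<^sub>R w)) (D (s *\<^sub>R w) w) (D (s *\<^sub>R w) w)" by (rule left)
    also have "\<dots> \<le> E\<^sup>2 / c * (3 * M)"
      using \<psi>(4)[of "s *\<^sub>R w" w] M[OF that] c(1) by (intro mult_left_mono) auto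
    finally show ?thesis unfolding Q_def by (rule real_le_rsqrt)
  qed
  have "Q \<ge> 0" using order_trans[OF norm_ge_zero speed[of 0, unfolded left_invariant_norm_def]] by simp
  \<comment> \<open>In the first factor the left-invariant norm is the plain norm, so the
    displacement is bounded at once. This confines \<open>fst (d s)\<close> to the ball for which
    \<open>P\<close> was chosen, and only then can the second factor be estimated.\<close>
  have "norm (fst (d s) - fst (d 0)) \<le> Q" if "0 \<le> s" "s \<le> 1" for s
  proof (rule curve_displacement_bound[where d = "\<lambda>s. fst (d s)" and d' = "\<lambda>s. fst (d' s)", OF _ _ that])
    fix s :: real assume s: "0 \<le> s" "s \<le> 1"
    show "((\<lambda>s. fst (d s)) has_vector_derivative fst (d' s)) (at s)"
      by (rule bounded_linear.has_vector_derivative[OF bounded_linear_fst deriv])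
    show "norm (fst (d' s)) \<le> Q"
      using speed[OF s] norm_fst_le unfolding left_invariant_norm_def by (rule order_trans[rotated])
  qed
  moreover have "norm (fst (d 0)) \<le> R"
    using R[of "d 0"] h(2) norm_fst_le[of "fst (d 0)" "snd (d 0)"] by (simp add: d_def)
  ultimately have fst_d: "fst (d s) \<in> cball 0 (R + Q)" if "0 \<le> s" "s \<le> 1" for s
    using norm_triangle_ineq[of "fst (d 0)" "fst (d s) - fst (d 0)"] that
    by (auto intro: order_trans add_mono)
  have "norm (snd (d 1) - snd (d 0)) \<le> \<bar>P\<bar> * Q"
  proof (rule curve_displacement_bound[where d = "\<lambda>s. snd (d s)" and d' = "\<lambda>s. snd (d' s)"])
    fix s :: real assume s: "0 \<le> s" "s \<le> 1"
    show "((\<lambda>s. snd (d s)) has_vector_derivative snd (d' s)) (at s)"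
      by (rule bounded_linear.has_vector_derivative[OF bounded_linear_snd deriv])
    have "norm (snd (d' s)) = norm (OT_phi C (fst (d s)) (OT_phi C (- fst (d s)) (snd (d' s))))" by simp
    also have "\<dots> \<le> P * norm (OT_phi C (- fst (d s)) (snd (d' s)))" by (rule P[OF fst_d[OF s]])
    also have "\<dots> \<le> \<bar>P\<bar> * Q"
      using speed[OF s] norm_snd_le[of "OT_phi C (- fst (d s)) (snd (d' s))" "fst (d' s)"]
      unfolding left_invariant_norm_def by (intro mult_mono) auto
    finally show "norm (snd (d' s)) \<le> \<bar>P\<bar> * Q" .
  qed auto
  \<comment> \<open>By equivariance the end points are the images under \<open>h\<close> of
    \<open>\<psi> 0\<close> and of its translate by \<open>emb 1\<close>; the linear part of
    \<open>h\<close> sends \<open>emb 1\<close> to \<open>emb u\<close>.\<close>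
  moreover have "snd (d 1) - snd (d 0) = emb u"
  proof -
    have "w = OT_act C w 0" by (simp add: OT_act_def w_def linear_0[OF OT_phi_linear] prod_eq_iff)
    then have "\<psi> w = OT_act C w (\<psi> 0)" using \<psi>(2)[OF wH] by metis
    then have "d 1 = OT_act C h (OT_act C w (\<psi> 0))" and "d 0 = OT_act C h (\<psi> 0)"
      by (simp_all add: d_def)
    then show ?thesis
      by (simp add: OT_act_def w_def uo linear_add[OF OT_phi_linear] OT_phi_emb)
  qed
  ultimately have "u \<in> S" using uo by (simp add: S_def)
  have "f h = f (log_embedding \<sigma> u, 0)"
    unfolding uo(1) by (rule lattice_hom_vanishes_on_integers[OF hom uo(2,3)])
  then have "\<bar>f h\<bar> \<le> B" using B[OF \<open>u \<in> S\<close>] by simp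
  moreover have "primitive (OT_act C h (\<psi> 0)) \<ge> primitive 0 + T + f h"
    using \<psi>(3)[of 0] prim[OF h(1)] by simp
  ultimately show False
    using F[OF h(2)] unfolding T_def by linarith
qed

end

section \<open>Charts of the quotient\<close>

lemma Ck_on_const: "Ck_on k S (\<lambda>x. c)"
  by (induction k arbitrary: c) (simp_all add: frechet_derivative_const)

lemma smooth_on_const: "smooth_on S (\<lambda>x. c)"
  by (simp add: smooth_on_def Ck_on_const)

lemma smooth_on_imp_has_derivative:
  assumes "smooth_on S f" "open S" "x \<in> S"
  shows "(f has_derivative ddir f x) (at x)"
proof -
  have "Ck_on (Suc 0) S f" using assms(1) unfolding smooth_on_def by blast
  then have "f differentiable (at x within S)" using assms(3) by (simp add: differentiable_on_def)
  then have "f differentiable (at x)" using at_within_open[OF assms(3,2)] by simp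
  then show ?thesis by (rule frechet_derivative_works[THEN iffD1])
qed

lemma smooth_on_imp_continuous_on: "smooth_on S f \<Longrightarrow> continuous_on S f"
  unfolding smooth_on_def by (auto dest: spec[of _ 0])

text \<open>The lowered difference \<open>S\<close> of the two symbols is symmetric in its first two
  arguments and skew in its last two, which forces it to vanish. This allows the symbols of
  different charts to be glued.\<close>

lemma Christoffel_unique:
  assumes b: "bilinear \<beta>" and pos: "\<And>v. v \<noteq> 0 \<Longrightarrow> \<beta> v v > (0::real)" and sym: "\<And>u v. \<beta> u v = \<beta> v u"
    and G: "\<And>u v. G u v = G v u" and G': "\<And>u v. G' u v = G' v u"
    and eq: "\<And>u v w. \<beta> (G u v) w + \<beta> v (G u w) = \<beta> (G' u v) w + \<beta> v (G' u w)"
  shows "G = G'"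
proof (intro ext)
  fix u v
  define S where "S u v w = \<beta> (G u v - G' u v) w" for u v w
  have skew: "S u v w = - S u w v" for u v w
    using eq[of u v w] sym[of v] by (simp add: S_def bilinear_lsub[OF b])
  have symm: "S u v w = S v u w" for u v w unfolding S_def using G G' by metis
  have "S u v w = 0" for w
    using skew[of u v w] symm[of u w v] skew[of w u v] symm[of w v u] skew[of v w u] symm[of v u w] by linarith
  then have "\<beta> (G u v - G' u v) (G u v - G' u v) = 0" unfolding S_def by blast
  then show "G u v = G' u v" using pos[of "G u v - G' u v"] by fastforce
qed

text \<open>The defining identities are evaluated on constant vector fields, whose derivatives
  vanish.\<close>

lemma levi_civita_onD:
  assumes "levi_civita_on S g \<Gamma>" "x \<in> S"
  shows "bilinear (\<Gamma> x)" "\<Gamma> x u v = \<Gamma> x v u"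
    "ddir (\<lambda>y. g y v w) x u = g x (\<Gamma> x u v) w + g x v (\<Gamma> x u w)"
    "continuous_on S (\<lambda>x. \<Gamma> x u v)"
proof -
  show "bilinear (\<Gamma> x)" "continuous_on S (\<lambda>x. \<Gamma> x u v)"
    using assms by (auto simp: levi_civita_on_def intro: smooth_on_imp_continuous_on)
  have "\<forall>x\<in>S. cov_deriv \<Gamma> (\<lambda>_. u) (\<lambda>_. v) x - cov_deriv \<Gamma> (\<lambda>_. v) (\<lambda>_. u) x = lie_bracket (\<lambda>_. u) (\<lambda>_. v) x"
    using assms(1) smooth_on_const unfolding levi_civita_on_def by blast
  then show "\<Gamma> x u v = \<Gamma> x v u"
    using assms(2) by (simp add: cov_deriv_def lie_bracket_def frechet_derivative_const)
  have "\<forall>x\<in>S. ddir (\<lambda>y. g y v w) x u =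
      g x (cov_deriv \<Gamma> (\<lambda>_. u) (\<lambda>_. v) x) w + g x v (cov_deriv \<Gamma> (\<lambda>_. u) (\<lambda>_. w) x)"
    using assms(1) smooth_on_const unfolding levi_civita_on_def by blast
  then show "ddir (\<lambda>y. g y v w) x u = g x (\<Gamma> x u v) w + g x v (\<Gamma> x u w)"
    using assms(2) by (simp add: cov_deriv_def frechet_derivative_const)
qed

context OT_data begin

section \<open>Lifting tensor fields from the quotient to the group\<close>

definition proj :: "(real ^ 's) \<times> (real ^ 's) \<times> (complex ^ 't) \<Rightarrow> ((real ^ 's) \<times> (real ^ 's) \<times> (complex ^ 't)) set" where
  "proj x = H #>\<^bsub>OT_group C\<^esub> x"

text \<open>The sets from which \<open>quotient_atlas\<close> makes its charts, seen as subsets of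
  the group; the chart image of \<open>chart_of V\<close> is \<open>V\<close> itself.\<close>

definition slice :: "((real ^ 's) \<times> (real ^ 's) \<times> (complex ^ 't)) set \<Rightarrow> bool" where
  "slice V \<longleftrightarrow> open V \<and> inj_on proj V"

definition chart_of :: "((real ^ 's) \<times> (real ^ 's) \<times> (complex ^ 't)) set \<Rightarrow>
    (((real ^ 's) \<times> (real ^ 's) \<times> (complex ^ 't)) set, (real ^ 's) \<times> (real ^ 's) \<times> (complex ^ 't)) chart" where
  "chart_of V = (proj ` V, inv_into V proj)"

abbreviation (input) "atlas \<equiv> quotient_atlas (OT_group C) H"

lemma atlas_eq: "atlas = chart_of ` {V. slice V}"
  unfolding quotient_atlas_def chart_of_def slice_def proj_def by auto

lemma chart_image_chart_of: "slice V \<Longrightarrow> chart_image (chart_of V) = V"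
  using quotient_chart(1)[of proj V "chart_of V"] by (simp add: slice_def chart_of_def)

lemma chart_inv_chart_of: "slice V \<Longrightarrow> x \<in> V \<Longrightarrow> chart_inv (chart_of V) x = proj x"
  using quotient_chart(2)[of proj V "chart_of V" x] by (simp add: slice_def chart_of_def)

lemma zero_in_H: "0 \<in> H"
  using U_1 by (auto simp: H_eq zero_prod_def[where 'b = "(real ^ 's) \<times> (complex ^ 't)"]
      log_embedding_1[symmetric] emb_0[symmetric])

lemma OT_act_0 [simp]: "OT_act C 0 x = x"
  by (simp add: OT_act_def)

lemma proj_eq: "proj x = (\<lambda>h. OT_act C h x) ` H"
proof -
  have "h \<otimes>\<^bsub>OT_group C\<^esub> x = OT_act C h x" for h
    by (cases h; cases x) (simp add: OT_group_def OT_act_def)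
  then show ?thesis by (auto simp: proj_def r_coset_def)
qed

lemma proj_eq_iff: "proj x = proj y \<longleftrightarrow> (\<exists>h\<in>H. y = OT_act C h x)"
proof
  assume "proj x = proj y"
  moreover have "y \<in> proj y" unfolding proj_eq using zero_in_H by (auto intro!: image_eqI[of _ _ 0])
  ultimately show "\<exists>h\<in>H. y = OT_act C h x" by (auto simp: proj_eq)
next
  assume "\<exists>h\<in>H. y = OT_act C h x"
  then obtain h where h: "h \<in> H" "y = OT_act C h x" by blast
  have sub: "proj (OT_act C h x) \<subseteq> proj x" if "h \<in> H" for h x
    unfolding proj_eq using that H_closed by (fastforce simp flip: OT_act_assoc intro: imageI)
  obtain k where "k \<in> H" "OT_act C k h = 0" using H_inverse[OF h(1)] by blast
  then have "k \<in> H" "x = OT_act C k y" by (simp_all add: h(2) flip: OT_act_assoc)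
  then show "proj x = proj y" using sub[OF h(1), of x] sub[of k y] h(2) by auto
qed

text \<open>Since \<open>proj\<close> is constant on orbits, the transition agrees with
  \<open>OT_act C h\<close> on the open set of points of \<open>V\<close> that \<open>h\<close>
  sends into \<open>W\<close>. The transformation law of a tensor field thereby becomes invariance
  of its lift.\<close>

lemma chart_transition:
  assumes V: "slice V" and W: "slice W" and x: "x \<in> V" and h: "h \<in> H" "OT_act C h x \<in> W"
  shows "x \<in> overlap (chart_of V) (chart_of W)"
    and "transition (chart_of V) (chart_of W) x = OT_act C h x"
    and "ddir (transition (chart_of V) (chart_of W)) x = OT_lin C h"
proof -
  have proj_act: "proj (OT_act C h z) = proj z" for z using h(1) proj_eq_iff by metis
  show "x \<in> overlap (chart_of V) (chart_of W)"
    unfolding overlap_def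
  proof (rule image_eqI)
    show "x = snd (chart_of V) (proj x)"
      using V x by (simp add: chart_of_def slice_def inv_into_f_f)
    show "proj x \<in> fst (chart_of V) \<inter> fst (chart_of W)"
      using imageI[OF x, of proj] imageI[OF h(2), of proj] by (simp add: chart_of_def proj_act)
  qed
  have tr: "transition (chart_of V) (chart_of W) z = OT_act C h z" if "z \<in> V" "OT_act C h z \<in> W" for z
  proof -
    have "transition (chart_of V) (chart_of W) z = inv_into W proj (proj (OT_act C h z))"
      using that by (simp add: transition_def chart_inv_chart_of[OF V] proj_act) (simp add: chart_of_def)
    then show ?thesis using that W by (simp add: slice_def inv_into_f_f)
  qed
  show "transition (chart_of V) (chart_of W) x = OT_act C h x" by (rule tr[OF x h(2)])
  have der: "(OT_act C h has_derivative OT_lin C h) (at z)" for z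
  proof -
    have "((\<lambda>z. OT_act C h 0 + OT_lin C h z) has_derivative OT_lin C h) (at z)"
      using linear_imp_has_derivative[OF OT_lin_linear, of C h] by (auto intro!: derivative_eq_intros)
    moreover have "(\<lambda>z. OT_act C h 0 + OT_lin C h z) = OT_act C h"
      by (rule ext) (simp flip: OT_act_affine)
    ultimately show ?thesis by simp
  qed
  have "continuous_on UNIV (OT_act C h)"
    by (rule continuous_at_imp_continuous_on) (use has_derivative_continuous[OF der] in blast)
  then have "open (V \<inter> OT_act C h -` W)"
    using V W by (intro open_Int open_vimage) (auto simp: slice_def)
  then have "(transition (chart_of V) (chart_of W) has_derivative OT_lin C h) (at x)"
    by (rule has_derivative_transform_within_open[OF der]) (use x h(2) tr in auto)
  then show "ddir (transition (chart_of V) (chart_of W)) x = OT_lin C h"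
    by (rule frechet_derivative_at[symmetric])
qed

text \<open>Right translations permute the charts, so one nonempty chart yields charts around all points.\<close>

lemma slice_around:
  assumes V: "slice V0" "x0 \<in> V0"
  obtains V where "slice V" "x \<in> V"
proof -
  \<comment> \<open>\<open>m\<close> is the inverse of \<open>x\<close> times \<open>x0\<close>, so
    that right translation by \<open>m\<close> takes \<open>x\<close> to \<open>x0\<close>.\<close>
  define m where "m = (fst x0 - fst x, OT_phi C (- fst x) (snd x0 - snd x))"
  have xm: "OT_act C x m = x0" by (simp add: m_def OT_act_def)
  let ?V = "(\<lambda>z. OT_act C z m) -` V0"
  have "continuous_on UNIV (\<lambda>z. OT_act C z m)"
    unfolding OT_act_def by (intro continuous_intros continuous_on_OT_phi)
  then have "open ?V" using V by (intro open_vimage) (auto simp: slice_def)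
  moreover have "inj_on proj ?V"
  proof (rule inj_onI)
    fix y z assume yz: "y \<in> ?V" "z \<in> ?V" "proj y = proj z"
    then obtain h where h: "h \<in> H" "z = OT_act C h y" using proj_eq_iff by blast
    then have "proj (OT_act C y m) = proj (OT_act C z m)" using proj_eq_iff OT_act_assoc by metis
    then have eq: "OT_act C y m = OT_act C z m" using yz V by (auto simp: slice_def dest: inj_onD)
    then show "y = z" by (auto simp: OT_act_def prod_eq_iff)
  qed
  ultimately show thesis using that[of ?V] V xm by (auto simp: slice_def)
qed

text \<open>A nonzero integer with small image would translate \<open>x0\<close> to another point of
  \<open>V\<close> in the same coset, against the injectivity of \<open>proj\<close> on
  \<open>V\<close>.\<close>

lemma integers_discrete:
  assumes V: "slice V" "x0 \<in> V"
  obtains e where "e > 0" "\<And>x. algebraic_int x \<Longrightarrow> norm (emb x) < e \<Longrightarrow> x = 0"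
proof -
  obtain e where e: "e > 0" "ball x0 e \<subseteq> V"
    using V unfolding slice_def open_contains_ball by blast
  have "x = 0" if x: "algebraic_int x" "norm (emb x) < e" for x
  proof -
    have h: "(0, emb x) \<in> H" using x U_1 by (auto simp: H_eq log_embedding_1[symmetric])
    have eq: "OT_act C (0, emb x) x0 = x0 + (0, emb x)"
      by (simp add: OT_act_def prod_eq_iff)
    have "x0 + (0, emb x) \<in> V" using x(2) e(2) by (auto simp: dist_norm norm_prod_def)
    moreover have "proj x0 = proj (x0 + (0, emb x))" using h eq proj_eq_iff by metis
    ultimately have "x0 = x0 + (0, emb x)"
      using V unfolding slice_def by (blast dest: inj_onD)
    then have "emb x = 0" by (simp add: prod_eq_iff)
    then show ?thesis by (simp add: emb_eq_0_iff)
  qed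
  then show thesis using that e(1) by blast
qed

lemma no_vaisman_structure: "\<not> vaisman_structure atlas J \<omega> \<theta>"
proof
  assume vaisman: "vaisman_structure atlas J \<omega> \<theta>"
  note defs = vaisman_structure_def LCK_structure_def hermitian_structure_def complex_structure_def
  have J: "is_endo_field atlas J" and \<omega>: "is_two_form atlas \<omega>" and \<theta>: "is_one_form atlas \<theta>"
    and J2: "\<And>c x v. c \<in> atlas \<Longrightarrow> x \<in> chart_image c \<Longrightarrow> J c x (J c x v) = - v"
    and J\<omega>: "\<And>c x u v. c \<in> atlas \<Longrightarrow> x \<in> chart_image c \<Longrightarrow> \<omega> c x (J c x u) (J c x v) = \<omega> c x u v"
    and pos: "\<And>c x v. c \<in> atlas \<Longrightarrow> x \<in> chart_image c \<Longrightarrow> v \<noteq> 0 \<Longrightarrow> metric_of J \<omega> c x v v > 0"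
    and not_exact: "\<not> exact_one_form atlas \<theta>"
    and parallel: "parallel_one_form atlas (metric_of J \<omega>) \<theta>"
    using vaisman unfolding defs by blast+
  define g\<^sub>V where "g\<^sub>V V = metric_of J \<omega> (chart_of V)" for V
  define \<theta>\<^sub>V where "\<theta>\<^sub>V V = \<theta> (chart_of V)" for V
  have in_atlas: "chart_of V \<in> atlas" if "slice V" for V using that by (simp add: atlas_eq)
  have J_linear: "linear (J (chart_of V) x)" and J_smooth: "smooth_on V (\<lambda>x. J (chart_of V) x v)"
    and \<omega>_bilinear: "bilinear (\<omega> (chart_of V) x)" and \<omega>_alt: "\<omega> (chart_of V) x v v = 0"
    and \<omega>_smooth: "smooth_on V (\<lambda>x. \<omega> (chart_of V) x u v)"
    and \<theta>_linear: "linear (\<theta>\<^sub>V V x)" and \<theta>_smooth: "smooth_on V (\<lambda>x. \<theta>\<^sub>V V x v)"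
    if "slice V" "x \<in> V" for V x u v
    using J \<omega> \<theta> in_atlas[OF that(1)] that(2) chart_image_chart_of[OF that(1)]
    unfolding is_endo_field_def is_two_form_def is_one_form_def \<theta>\<^sub>V_def by metis+
  have g_bilinear: "bilinear (g\<^sub>V V x)" if "slice V" "x \<in> V" for V x
  proof -
    have "linear (\<omega> (chart_of V) x u)" "linear (\<lambda>u. \<omega> (chart_of V) x u v)" for u v
      using \<omega>_bilinear[OF that] unfolding bilinear_def by blast+
    then show ?thesis
      using linear_compose[OF J_linear[OF that]]
      unfolding g\<^sub>V_def metric_of_def bilinear_def o_def by blast
  qed
  \<comment> \<open>Symmetry combines three facts: \<open>\<omega>\<close> is
    \<open>J\<close>-invariant, \<open>J\<close> squares to minus the identity, and
    \<open>\<omega>\<close> is skew.\<close>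
  have g_sym: "g\<^sub>V V x u v = g\<^sub>V V x v u" if V: "slice V" "x \<in> V" for V x u v
  proof -
    have alt: "\<omega> (chart_of V) x a b = - \<omega> (chart_of V) x b a" for a b
    proof -
      have "\<omega> (chart_of V) x (a + b) (a + b) = \<omega> (chart_of V) x a a + \<omega> (chart_of V) x a b
          + (\<omega> (chart_of V) x b a + \<omega> (chart_of V) x b b)"
        by (simp add: bilinear_ladd[OF \<omega>_bilinear[OF V]] bilinear_radd[OF \<omega>_bilinear[OF V]])
      then show ?thesis
        using \<omega>_alt[OF V, of "a + b"] \<omega>_alt[OF V, of a] \<omega>_alt[OF V, of b] by linarith
    qed
    have "\<omega> (chart_of V) x v (J (chart_of V) x u)
        = \<omega> (chart_of V) x (J (chart_of V) x v) (J (chart_of V) x (J (chart_of V) x u))"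
      using J\<omega>[OF in_atlas[OF V(1)]] V by (simp add: chart_image_chart_of)
    also have "\<dots> = - \<omega> (chart_of V) x (J (chart_of V) x v) u"
      using J2[OF in_atlas[OF V(1)]] V by (simp add: chart_image_chart_of bilinear_rneg[OF \<omega>_bilinear[OF V]])
    also have "\<dots> = \<omega> (chart_of V) x u (J (chart_of V) x v)" using alt[of u] by simp
    finally show ?thesis by (simp add: g\<^sub>V_def metric_of_def)
  qed
  have g_pos: "g\<^sub>V V x v v > 0" if "slice V" "x \<in> V" "v \<noteq> 0" for V x v
    using pos[OF in_atlas[OF that(1)]] that by (simp add: g\<^sub>V_def chart_image_chart_of)
  \<comment> \<open>\<open>levi_civita_on\<close> speaks only of \<open>ddir\<close>, which has some
    value even where no derivative exists. Differentiability of the metric has to come from the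
    smoothness of \<open>\<omega>\<close> and \<open>J\<close>.\<close>
  have g_differentiable: "((\<lambda>x. g\<^sub>V V x u v) has_derivative ddir (\<lambda>x. g\<^sub>V V x u v) x) (at x)"
    if V: "slice V" "x \<in> V" for V x u v
  proof -
    have op: "open V" using V by (simp add: slice_def)
    let ?D = "\<lambda>h. \<Sum>b\<in>Basis. (J (chart_of V) x v \<bullet> b) *\<^sub>R ddir (\<lambda>x. \<omega> (chart_of V) x u b) x h
        + (ddir (\<lambda>x. J (chart_of V) x v) x h \<bullet> b) *\<^sub>R \<omega> (chart_of V) x u b"
    have D: "((\<lambda>x. \<Sum>b\<in>Basis. (J (chart_of V) x v \<bullet> b) *\<^sub>R \<omega> (chart_of V) x u b) has_derivative ?D) (at x)"
      by (intro has_derivative_sum has_derivative_scaleR has_derivative_inner_left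
          smooth_on_imp_has_derivative[OF J_smooth[OF V] op V(2)]
          smooth_on_imp_has_derivative[OF \<omega>_smooth[OF V] op V(2)])
    have "((\<lambda>x. g\<^sub>V V x u v) has_derivative ?D) (at x)"
    proof (rule has_derivative_transform_within_open[OF D op V(2)])
      fix y assume y: "y \<in> V"
      have "linear (\<omega> (chart_of V) y u)" using \<omega>_bilinear[OF V(1) y] unfolding bilinear_def by blast
      from linear_basis_expansion[OF this, of "J (chart_of V) y v"]
      show "(\<Sum>b\<in>Basis. (J (chart_of V) y v \<bullet> b) *\<^sub>R \<omega> (chart_of V) y u b) = g\<^sub>V V y u v"
        by (simp add: g\<^sub>V_def metric_of_def)
    qed
    then have "(\<lambda>x. g\<^sub>V V x u v) differentiable (at x)" unfolding differentiable_def by blast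
    then show ?thesis by (rule frechet_derivative_works[THEN iffD1])
  qed
  have invariant: "\<theta>\<^sub>V W (OT_act C h x) (OT_lin C h v) = \<theta>\<^sub>V V x v"
    "g\<^sub>V W (OT_act C h x) (OT_lin C h u) (OT_lin C h v) = g\<^sub>V V x u v"
    if V: "slice V" "x \<in> V" and W: "slice W" and h: "h \<in> H" "OT_act C h x \<in> W" for V W x h u v
  proof -
    note tr = chart_transition[OF V(1) W V(2) h]
    show "\<theta>\<^sub>V W (OT_act C h x) (OT_lin C h v) = \<theta>\<^sub>V V x v"
      using \<theta> in_atlas[OF V(1)] in_atlas[OF W] tr unfolding is_one_form_def \<theta>\<^sub>V_def by metis
    have w: "\<omega> (chart_of W) (OT_act C h x) (OT_lin C h a) (OT_lin C h b) = \<omega> (chart_of V) x a b" for a b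
      using \<omega> in_atlas[OF V(1)] in_atlas[OF W] tr unfolding is_two_form_def by metis
    have "OT_lin C h (J (chart_of V) x b) = J (chart_of W) (OT_act C h x) (OT_lin C h b)" for b
      using J in_atlas[OF V(1)] in_atlas[OF W] tr unfolding is_endo_field_def by metis
    then show "g\<^sub>V W (OT_act C h x) (OT_lin C h u) (OT_lin C h v) = g\<^sub>V V x u v"
      unfolding g\<^sub>V_def metric_of_def by (metis w)
  qed
  have lin0: "OT_lin C 0 = (\<lambda>v. v)" by (simp add: OT_lin_def fun_eq_iff)
  \<comment> \<open>The case of the neutral lattice element: two slices through the same point carry
    the same tensors there.\<close>
  have agree: "\<theta>\<^sub>V W x = \<theta>\<^sub>V V x" "g\<^sub>V W x = g\<^sub>V V x"
    if "slice V" "x \<in> V" "slice W" "x \<in> W" for V W x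
    using invariant[OF that(1-3) zero_in_H] that(4) by (auto simp: lin0 fun_eq_iff)
  have "\<exists>\<Gamma>. levi_civita_on V (g\<^sub>V V) \<Gamma> \<and> (\<forall>x\<in>V. \<forall>u v. ddir (\<lambda>y. \<theta>\<^sub>V V y v) x u = \<theta>\<^sub>V V x (\<Gamma> x u v))"
    if V: "slice V" for V
  proof -
    obtain \<Gamma> where \<Gamma>: "levi_civita_on V (g\<^sub>V V) \<Gamma>"
      and par: "\<And>X Y x. smooth_on V X \<Longrightarrow> smooth_on V Y \<Longrightarrow> x \<in> V \<Longrightarrow>
        ddir (\<lambda>y. \<theta>\<^sub>V V y (Y y)) x (X x) - \<theta>\<^sub>V V x (cov_deriv \<Gamma> X Y x) = 0"
      using bspec[OF parallel[unfolded parallel_one_form_def] in_atlas[OF V],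
          unfolded chart_image_chart_of[OF V], folded g\<^sub>V_def \<theta>\<^sub>V_def] by blast
    have "ddir (\<lambda>y. \<theta>\<^sub>V V y v) x u = \<theta>\<^sub>V V x (\<Gamma> x u v)" if "x \<in> V" for x u v
      using par[OF smooth_on_const smooth_on_const that, of v u]
      by (simp add: cov_deriv_def frechet_derivative_const)
    then show ?thesis using \<Gamma> by blast
  qed
  then obtain \<Gamma>\<^sub>V where LC: "\<And>V. slice V \<Longrightarrow> levi_civita_on V (g\<^sub>V V) (\<Gamma>\<^sub>V V)"
    and par: "\<And>V x u v. slice V \<Longrightarrow> x \<in> V \<Longrightarrow> ddir (\<lambda>y. \<theta>\<^sub>V V y v) x u = \<theta>\<^sub>V V x (\<Gamma>\<^sub>V V x u v)"
    by metis
  \<comment> \<open>If the form vanished in every chart, the constant function 0 would be a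
    primitive, even for an empty atlas. Non-exactness thus also provides a nonempty slice.\<close>
  obtain V0 x0 v0 where V0: "slice V0" "x0 \<in> V0" "\<theta>\<^sub>V V0 x0 v0 \<noteq> 0"
  proof (rule ccontr)
    assume "\<not> thesis"
    then have zero: "\<theta> (chart_of V) x v = 0" if "slice V" "x \<in> V" for V x v
      using that unfolding \<theta>\<^sub>V_def using \<open>\<And>V0 x0 v0. slice V0 \<Longrightarrow> x0 \<in> V0 \<Longrightarrow> \<theta>\<^sub>V V0 x0 v0 \<noteq> 0 \<Longrightarrow> thesis\<close> \<theta>\<^sub>V_def by metis
    have "exact_one_form atlas \<theta>"
      unfolding exact_one_form_def
    proof (intro exI[of _ "\<lambda>_. 0"] conjI ballI allI)
      show "smooth_function atlas (\<lambda>_. 0)"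
        by (simp add: smooth_function_def o_def smooth_on_const)
      fix c x v assume "c \<in> atlas" "x \<in> chart_image c"
      then show "\<theta> c x v = ddir ((\<lambda>_. 0) \<circ> chart_inv c) x v"
        by (auto simp: atlas_eq chart_image_chart_of zero o_def frechet_derivative_const)
    qed
    then show False using not_exact by blast
  qed
  have "\<exists>V. slice V \<and> x \<in> V" for x using slice_around[OF V0(1,2)] by metis
  \<comment> \<open>The slice \<open>V x\<close> is an arbitrary choice that need not vary
    continuously. Derivatives and continuity are therefore checked in one fixed slice near each
    point, by \<open>g_eq\<close>, \<open>\<eta>_eq\<close> and \<open>\<Gamma>_eq\<close>.\<close>
  then obtain V where V: "\<And>x. slice (V x)" "\<And>x. x \<in> V x" by metis
  define g where "g x = g\<^sub>V (V x) x" for x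
  define \<eta> where "\<eta> x = \<theta>\<^sub>V (V x) x" for x
  define \<Gamma> where "\<Gamma> x = \<Gamma>\<^sub>V (V x) x" for x
  have g_eq: "g y = g\<^sub>V W y" and \<eta>_eq: "\<eta> y = \<theta>\<^sub>V W y" if "slice W" "y \<in> W" for W y
    using agree[OF that V] by (simp_all add: g_def \<eta>_def)
  have g_deriv: "((\<lambda>y. g y u v) has_derivative ddir (\<lambda>y. g\<^sub>V W y u v) x) (at x)"
    if W: "slice W" "x \<in> W" for W x u v
    by (rule has_derivative_transform_within_open[OF g_differentiable[OF W], of W])
      (use W in \<open>auto simp: g_eq slice_def\<close>)
  have \<Gamma>_eq: "\<Gamma> x = \<Gamma>\<^sub>V W x" if W: "slice W" "x \<in> W" for W x
  proof (rule Christoffel_unique[where \<beta> = "g x"])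
    show "bilinear (g x)" "\<And>v. v \<noteq> 0 \<Longrightarrow> g x v v > 0" "\<And>u v. g x u v = g x v u"
      using g_bilinear[OF V] g_pos[OF V] g_sym[OF V] by (simp_all add: g_def)
    show "\<Gamma> x u v = \<Gamma> x v u" "\<Gamma>\<^sub>V W x u v = \<Gamma>\<^sub>V W x v u" for u v
      unfolding \<Gamma>_def using levi_civita_onD(2)[OF LC[OF V(1)] V(2)] levi_civita_onD(2)[OF LC[OF W(1)] W(2)] by blast+
    fix u v w
    have "g x (\<Gamma> x u v) w + g x v (\<Gamma> x u w) = ddir (\<lambda>y. g\<^sub>V (V x) y v w) x u"
      by (simp add: levi_civita_onD(3)[OF LC[OF V(1)] V(2)] g_def \<Gamma>_def)
    also have "\<dots> = ddir (\<lambda>y. g\<^sub>V W y v w) x u"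
      by (simp only: has_derivative_unique[OF g_deriv[OF V] g_deriv[OF W]])
    also have "\<dots> = g x (\<Gamma>\<^sub>V W x u v) w + g x v (\<Gamma>\<^sub>V W x u w)"
      by (simp add: levi_civita_onD(3)[OF LC[OF W(1)] W(2)] g_eq[OF W])
    finally show "g x (\<Gamma> x u v) w + g x v (\<Gamma> x u w) = g x (\<Gamma>\<^sub>V W x u v) w + g x v (\<Gamma>\<^sub>V W x u w)" .
  qed
  obtain K where K: "compact K" "\<And>x. \<exists>h\<in>H. OT_act C h x \<in> K" using H_cocompact by blast
  have "parallel_one_form_data g \<Gamma> \<eta> H (OT_act C) (OT_lin C) K"
  proof (rule parallel_one_form_data.intro)
    fix x u v
    show "bilinear (g x)" using g_bilinear[OF V] by (simp add: g_def)
    show "g x u v = g x v u" using g_sym[OF V] by (simp add: g_def)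
    show "v \<noteq> 0 \<Longrightarrow> g x v v > 0" using g_pos[OF V] by (simp add: g_def)
    show "bilinear (\<Gamma> x)" using levi_civita_onD(1)[OF LC[OF V(1)] V(2)] by (simp add: \<Gamma>_def)
    show "\<Gamma> x u v = \<Gamma> x v u" using levi_civita_onD(2)[OF LC[OF V(1)] V(2)] by (simp add: \<Gamma>_def)
    have "ddir (\<lambda>y. g\<^sub>V (V x) y u v) x = (\<lambda>w. g x (\<Gamma> x w u) v + g x u (\<Gamma> x w v))"
      using levi_civita_onD(3)[OF LC[OF V(1)] V(2)[of x]] by (simp add: g_def \<Gamma>_def fun_eq_iff)
    then show "((\<lambda>x. g x u v) has_derivative (\<lambda>w. g x (\<Gamma> x w u) v + g x u (\<Gamma> x w v))) (at x)"
      using g_deriv[OF V, of u v x] by simp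
    have "isCont (\<lambda>y. \<Gamma> y u v) x" for x
    proof -
      have "continuous_on (V x) (\<lambda>y. \<Gamma>\<^sub>V (V x) y u v)"
        by (rule levi_civita_onD(4)[OF LC[OF V(1)] V(2)])
      then have "continuous_on (V x) (\<lambda>y. \<Gamma> y u v)"
        by (rule continuous_on_eq) (simp add: \<Gamma>_eq[OF V(1)])
      then show ?thesis using V[of x] by (auto simp: slice_def continuous_on_eq_continuous_at)
    qed
    then show "continuous_on UNIV (\<lambda>y. \<Gamma> y u v)" by (simp add: continuous_at_imp_continuous_on)
    show "linear (\<eta> x)" using \<theta>_linear[OF V] by (simp add: \<eta>_def)
    have "((\<lambda>y. \<theta>\<^sub>V (V x) y v) has_derivative ddir (\<lambda>y. \<theta>\<^sub>V (V x) y v) x) (at x)"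
      using smooth_on_imp_has_derivative[OF \<theta>_smooth[OF V] _ V(2)] V(1)[of x] by (simp add: slice_def)
    moreover have "ddir (\<lambda>y. \<theta>\<^sub>V (V x) y v) x = (\<lambda>w. \<eta> x (\<Gamma> x w v))"
      using par[OF V] by (simp add: \<eta>_def \<Gamma>_def fun_eq_iff)
    ultimately have "((\<lambda>y. \<theta>\<^sub>V (V x) y v) has_derivative (\<lambda>w. \<eta> x (\<Gamma> x w v))) (at x)" by simp
    then show "((\<lambda>x. \<eta> x v) has_derivative (\<lambda>w. \<eta> x (\<Gamma> x w v))) (at x)"
      by (rule has_derivative_transform_within_open[of _ _ _ _ "V x"])
        (use V[of x] \<eta>_eq[OF V(1)[of x]] in \<open>auto simp: slice_def\<close>)
    show "\<exists>x v. \<eta> x v \<noteq> 0" using V0 \<eta>_eq by metis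
    show "compact K" by (rule K(1))
    show "\<exists>h\<in>H. OT_act C h x \<in> K" by (rule K(2))
    fix h
    show "OT_act C h (x + v) = OT_act C h x + OT_lin C h v" by (rule OT_act_affine)
    show "linear (OT_lin C h)" by (rule OT_lin_linear)
    show "surj (OT_lin C h)" by (rule OT_lin_surj)
    show "h \<in> H \<Longrightarrow> g (OT_act C h x) (OT_lin C h u) (OT_lin C h v) = g x u v"
      using invariant(2)[OF V V(1) _ V(2)] by (simp add: g_def)
    show "h \<in> H \<Longrightarrow> \<eta> (OT_act C h x) (OT_lin C h v) = \<eta> x v"
      using invariant(1)[OF V V(1) _ V(2)] by (simp add: \<eta>_def)
  qed
  moreover obtain e where "e > 0" "\<And>x. algebraic_int x \<Longrightarrow> norm (emb x) < e \<Longrightarrow> x = 0"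
    using integers_discrete[OF V0(1,2)] by blast
  ultimately show False by (rule no_equivariant_parallel_form)
qed

end

theorem proposition3p1:
  fixes \<sigma> :: "'s::finite \<Rightarrow> 'k::field_char_0 \<Rightarrow> real"
    and \<tau> :: "'t::finite \<Rightarrow> 'k \<Rightarrow> complex"
    and U :: "'k set"
    and C :: "complex ^ 's ^ 't"
  assumes "number_field TYPE('k)"
    and "lists_embeddings \<sigma> \<tau>"
    and "subgroup U (positive_units \<sigma>)"
    and "(positive_units \<sigma>)\<lparr>carrier := U\<rparr> \<cong> free_Abelian_group (UNIV :: 's set)"
    and "lattice_in_space (log_embedding \<sigma> ` U)"
    and "\<forall>u\<in>U. \<forall>i. \<tau> i u = exp (\<Sum>j\<in>UNIV. C $ i $ j * of_real (ln (\<sigma> j u)))"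
  shows "\<not> (\<exists>J \<omega> \<theta>.
    vaisman_structure (quotient_atlas (OT_group C) (OT_lattice \<sigma> \<tau> U)) J \<omega> \<theta>)"
proof -
  interpret OT_data \<sigma> \<tau> U C by (intro OT_data.intro assms)
  show ?thesis using no_vaisman_structure by blast
qed

end
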